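(* Let $P$ and $Q$ be rational polygons of denominator $d$, and suppose $P$ and $Q$ are rationally finitely discretely equidecomposable. Then $W_d(P) = W_d(Q)$.
   Context: A rational polygon (not necessarily convex) has denominator $d$ if $d$ is the least positive integer with $dP$ having integer vertices. $G = GL_2(\mathbb{Z}) \ltimes \mathbb{Z}^2$ acts on $\mathbb{R}^2$ by $x\mapsto Ux+v$. An open simplex is a point, relatively open segment or open triangle; rational if its vertices are rational. $P,Q$ are rationally finitely discretely equidecomposable if there exist finitely many rational open simplices $T_1,\dots,T_r$ and $G$-maps $g_1,\dots,g_r$ with $P=\bigsqcup_i T_i$ and $Q=\bigsqcup_i g_i(T_i)$. A segment with endpoints in $\frac{1}{d}\mathbb{Z}^2$ is $d$-minimal if it contains no other points of $\frac{1}{d}\mathbb{Z}^2$; for an oriented $d$-minimal segment from $p=(w/d,x/d)$ to $q=(y/d,z/d)$ its weight is $wz-xy \bmod d$. With the boundary of $P$ oriented counterclockwise, it is uniquely a union of oriented $d$-minimal segments, and $W_d(P)$ is the multiset of their weights (residues mod $d$). *)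

theory Defs
  imports "HOL-Complex_Analysis.Complex_Analysis" "HOL-Library.Multiset"
    "HOL-Library.Disjoint_Sets"
begin

text \<open>The plane $R^2$ is the type \<^typ>\<open>complex\<close>, on which the library develops Jordan curves and
  winding numbers; multiplication of complex numbers is only used for real dilations.\<close>

definition lattice :: "nat \<Rightarrow> complex set"  \<comment> \<open>the points of $(1/d) Z^2$, for \<open>d > 0\<close>\<close>
  where "lattice d = {z. of_nat d * Re z \<in> \<int> \<and> of_nat d * Im z \<in> \<int>}"

definition rational_points :: "complex set"
  where "rational_points = {z. Re z \<in> \<rat> \<and> Im z \<in> \<rat>}"

fun polygonal_path :: "complex list \<Rightarrow> real \<Rightarrow> complex" where
  "polygonal_path [] = linepath 0 0"
| "polygonal_path [a] = linepath a a"
| "polygonal_path [a, b] = linepath a b"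
| "polygonal_path (a # b # c # vs) = linepath a b +++ polygonal_path (b # c # vs)"

definition closed_polygonal_path :: "complex list \<Rightarrow> real \<Rightarrow> complex"
  where "closed_polygonal_path vs = polygonal_path (vs @ [hd vs])"

text \<open>\<open>polygon_with_vertices vs P\<close>: the set \<open>P\<close> is the closed region bounded by the simple closed
  polygonal curve through \<open>vs\<close>. Straight angles are excluded, so that \<open>vs\<close> lists exactly the
  vertices of \<open>P\<close> (it is unique up to rotation and reversal).\<close>

definition polygon_with_vertices :: "complex list \<Rightarrow> complex set \<Rightarrow> bool"
  where "polygon_with_vertices vs P \<longleftrightarrow>
    length vs \<ge> 3 \<and>
    simple_path (closed_polygonal_path vs) \<and>
    (\<forall>i < length vs. \<not> collinear {vs ! i, vs ! ((i + 1) mod length vs), vs ! ((i + 2) mod length vs)}) \<and>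
    P = path_image (closed_polygonal_path vs) \<union> inside (path_image (closed_polygonal_path vs))"

definition rational_polygon :: "complex set \<Rightarrow> bool"
  where "rational_polygon P \<longleftrightarrow> (\<exists>vs. polygon_with_vertices vs P \<and> set vs \<subseteq> rational_points)"

definition integral_polygon :: "complex set \<Rightarrow> bool"
  where "integral_polygon P \<longleftrightarrow> (\<exists>vs. polygon_with_vertices vs P \<and> set vs \<subseteq> lattice 1)"

definition denominator :: "complex set \<Rightarrow> nat"
  where "denominator P = (LEAST d. d > 0 \<and> integral_polygon ((\<lambda>z. of_nat d * z) ` P))"

text \<open>Over the integers, \<^const>\<open>invertible\<close> means having an integer inverse matrix.\<close>

definition affine_action :: "int^2^2 \<Rightarrow> int^2 \<Rightarrow> complex \<Rightarrow> complex"
  where "affine_action U v z =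
    Complex (of_int (U $ 1 $ 1) * Re z + of_int (U $ 1 $ 2) * Im z + of_int (v $ 1))
            (of_int (U $ 2 $ 1) * Re z + of_int (U $ 2 $ 2) * Im z + of_int (v $ 2))"

definition G_maps :: "(complex \<Rightarrow> complex) set"
  where "G_maps = {affine_action U v | U v. invertible U}"

definition rational_open_simplex :: "complex set \<Rightarrow> bool"
  where "rational_open_simplex T \<longleftrightarrow>
    (\<exists>V. V \<noteq> {} \<and> V \<subseteq> rational_points \<and> \<not> affine_dependent V \<and> T = rel_interior (convex hull V))"

definition equidecomposable :: "complex set \<Rightarrow> complex set \<Rightarrow> bool"
  where "equidecomposable P Q \<longleftrightarrow>
    (\<exists>(r::nat) T g.
      (\<forall>i < r. rational_open_simplex (T i) \<and> g i \<in> G_maps) \<and>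
      disjoint_family_on T {..<r} \<and> P = (\<Union>i<r. T i) \<and>
      disjoint_family_on (\<lambda>i. g i ` T i) {..<r} \<and> Q = (\<Union>i<r. g i ` T i))"

definition minimal_segment :: "nat \<Rightarrow> complex \<Rightarrow> complex \<Rightarrow> bool"
  where "minimal_segment d p q \<longleftrightarrow> p \<noteq> q \<and> closed_segment p q \<inter> lattice d = {p, q}"

text \<open>For \<open>p\<close> and \<open>q\<close> in \<^term>\<open>lattice d\<close> the floors are exact: they read off the integer
  numerators. Residues modulo \<open>d\<close> are represented by \<open>0, \<dots>, d - 1\<close>.\<close>

definition weight :: "nat \<Rightarrow> complex \<Rightarrow> complex \<Rightarrow> int"
  where "weight d p q =
    (let w = \<lfloor>of_nat d * Re p\<rfloor>; x = \<lfloor>of_nat d * Im p\<rfloor>;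
         y = \<lfloor>of_nat d * Re q\<rfloor>; z = \<lfloor>of_nat d * Im q\<rfloor>
     in (w * z - x * y) mod int d)"

definition counterclockwise :: "complex list \<Rightarrow> bool"
  where "counterclockwise vs \<longleftrightarrow>
    (\<forall>z \<in> inside (path_image (closed_polygonal_path vs)).
      winding_number (closed_polygonal_path vs) z = 1)"

text \<open>The \<open>d\<close>-minimal segments \<open>(p, q)\<close> on the boundary of \<open>P\<close>, pointing in the direction in which
  the counterclockwise boundary curve traverses the edge containing them.\<close>

definition boundary_segments :: "nat \<Rightarrow> complex set \<Rightarrow> (complex \<times> complex) set"
  where "boundary_segments d P =
    {(p, q). minimal_segment d p q \<and>
      (\<exists>vs i. polygon_with_vertices vs P \<and> counterclockwise vs \<and> i < length vs \<and>
        closed_segment p q \<subseteq> closed_segment (vs ! i) (vs ! ((i + 1) mod length vs)) \<and>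
        (\<exists>c>0. q - p = c *\<^sub>R (vs ! ((i + 1) mod length vs) - vs ! i)))}"

text \<open>A polygon is bounded and \<^term>\<open>lattice d\<close> is discrete for \<open>d > 0\<close>, so the set of boundary
  segments is finite and \<^const>\<open>mset_set\<close> does not collapse to the empty multiset.\<close>

definition weights :: "nat \<Rightarrow> complex set \<Rightarrow> int multiset"
  where "weights d P = image_mset (\<lambda>(p, q). weight d p q) (mset_set (boundary_segments d P))"

end

(* Let s = (p, q) be an oriented d-minimal segment, theta an irrational number in (0, 1) and
   x = p + theta (q - p), a point lying on no rational line other than the one through p and q.
   For a set S let f_S(s) = [x in S] - [S contains the points near x to the right of s].
   If S is a polygon with vertices in (1/d) Z^2, then f_S(s) is 1 when s is one of the
   counterclockwise boundary segments of S and 0 otherwise. Since each rational open simplex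
   contains all or none of the points near x on the right of s, f is additive over
   the pieces of a decomposition. Each simplex has f nonzero on finitely many segments only, so we
   may sum f (for theta and 1 - theta) over all s of a given weight. G permutes these segments,
   an orientation reversing map acting by (p, q) -> (g q, g p), and the sum is invariant.
   Hence the number of boundary segments of each weight is the same for P and Q. *)

theory Submission imports Defs begin

section \<open>Simple polygons\<close>

text \<open>The pieces may have denominators unrelated to d, so their faces need not be unions of
  d-minimal segments. Testing each segment at one irrational point avoids any common refinement:
  such a point is never a vertex of a piece, and it sees a face only if that face is parallel to the
  segment.

  The asymmetric form of f matters. The left germ minus the right germ would be additive too, but it
  is -1 on reversed boundary segments; as reversal negates weights, its sum would only give the
  number of segments of weight k minus the number of weight -k. Comparing the point itself with its
  right side gives 0 on reversed segments. It uses the lower-dimensional pieces: an open segment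
  counts +1 in both directions, an open triangle -1 where it lies on the right.

  A polygon is given by a simple curve and its inside, so that the interior lies to the left of a
  counterclockwise edge rests on the Jordan curve theorem and on winding numbers. Vertex lists may
  run either way, and \<open>boundary_segments\<close> admits every counterclockwise list; germs of
  P itself reconcile them.\<close>

lemma polygonal_path_Cons:
  "length W \<ge> 2 \<Longrightarrow> polygonal_path (a # W) = linepath a (hd W) +++ polygonal_path W"
  by (cases W rule: polygonal_path.cases) auto

lemma pathstart_polygonal_path [simp]: "W \<noteq> [] \<Longrightarrow> pathstart (polygonal_path W) = hd W"
  by (induction W rule: polygonal_path.induct) auto

lemma pathfinish_polygonal_path [simp]: "W \<noteq> [] \<Longrightarrow> pathfinish (polygonal_path W) = last W"
  by (induction W rule: polygonal_path.induct) auto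

lemma path_polygonal_path [simp]: "path (polygonal_path W)"
  by (induction W rule: polygonal_path.induct) (auto, (simp add: path_def)+)

lemma arc_linepath_iff: "arc (linepath a b) \<longleftrightarrow> a \<noteq> b"
  by (metis arc_distinct_ends arc_linepath pathfinish_linepath pathstart_linepath)

lemma path_image_polygonal_path:
  "length W \<ge> 2 \<Longrightarrow>
    path_image (polygonal_path W) = (\<Union>i<length W - 1. closed_segment (W ! i) (W ! Suc i))"
proof (induction W rule: polygonal_path.induct)
  case (4 a b c vs)
  then show ?case
    by (simp add: path_image_join lessThan_Suc_eq_insert_0 image_image)
qed (auto simp: lessThan_Suc)

lemma winding_number_polygonal_path:
  assumes "length W \<ge> 2" "z \<notin> path_image (polygonal_path W)"
  shows "winding_number (polygonal_path W) z =
    (\<Sum>i<length W - 1. winding_number (linepath (W ! i) (W ! Suc i)) z)"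
  using assms
proof (induction W rule: polygonal_path.induct)
  case (4 a b c vs)
  then show ?case
    by (simp add: path_image_join winding_number_join sum.lessThan_Suc_shift del: sum.lessThan_Suc)
qed (auto simp: lessThan_Suc)

text \<open>Two edges can then touch only in a common end point; which end points coincide is left
  to a separate \<open>distinct\<close>. Exchanging \<open>a\<close> and \<open>b\<close> does not
  affect the condition.\<close>

definition disjoint_edges :: "nat \<Rightarrow> (nat \<Rightarrow> complex) \<Rightarrow> (nat \<Rightarrow> complex) \<Rightarrow> bool"
  where "disjoint_edges n a b \<longleftrightarrow>
    (\<forall>i<n. \<forall>j<n. i \<noteq> j \<longrightarrow> open_segment (a i) (b i) \<inter> closed_segment (a j) (b j) = {})"

lemma disjoint_edges_Suc:
  "disjoint_edges (Suc n) a b \<longleftrightarrow> disjoint_edges n (\<lambda>i. a (Suc i)) (\<lambda>i. b (Suc i)) \<and>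
    (\<forall>j<n. open_segment (a 0) (b 0) \<inter> closed_segment (a (Suc j)) (b (Suc j)) = {} \<and>
      open_segment (a (Suc j)) (b (Suc j)) \<inter> closed_segment (a 0) (b 0) = {})"
  unfolding disjoint_edges_def All_less_Suc2 by fastforce

lemma disjoint_edges_vertex:
  assumes "disjoint_edges (length W - 1) (\<lambda>i. W ! i) (\<lambda>i. W ! Suc i)" "length W \<ge> 2"
    and "v \<in> set W" "i < length W - 1"
  shows "v \<notin> open_segment (W ! i) (W ! Suc i)"
proof
  assume v: "v \<in> open_segment (W ! i) (W ! Suc i)"
  obtain k where k: "k < length W" "v = W ! k"
    using assms by (auto simp: in_set_conv_nth)
  \<comment> \<open>The last vertex starts no edge, so the edge ending there is taken
    instead.\<close>
  define j where "j = (if k < length W - 1 then k else k - 1)"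
  have j: "j < length W - 1" "k = j \<or> k = Suc j"
    using k assms(2) by (auto simp: j_def)
  then have "v \<in> closed_segment (W ! j) (W ! Suc j)"
    using k by auto
  then have "j = i"
    using assms v j unfolding disjoint_edges_def by blast
  then show False
    using v j k by (auto simp: open_segment_def)
qed

text \<open>Induction by prepending one edge: the longer path is an arc iff the new edge meets the
  old arc only in the joint \<open>b\<close>.\<close>

lemma arc_polygonal_path_iff:
  "length W \<ge> 2 \<Longrightarrow> arc (polygonal_path W) \<longleftrightarrow>
    distinct W \<and> disjoint_edges (length W - 1) (\<lambda>i. W ! i) (\<lambda>i. W ! Suc i)"
proof (induction W rule: polygonal_path.induct)
  case (4 a b c vs)
  define R where "R = b # c # vs"
  define n where "n = length R - 1"
  have n: "length (a # R) - 1 = Suc n" and R: "length R \<ge> 2" "R ! 0 = b" "hd R = b" "R \<noteq> []"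
    by (auto simp: n_def R_def)
  have im: "path_image (polygonal_path R) = (\<Union>i<n. closed_segment (R ! i) (R ! Suc i))"
    using path_image_polygonal_path[of R] by (simp add: n_def R_def)
  have IH: "arc (polygonal_path R) \<longleftrightarrow>
      distinct R \<and> disjoint_edges n (\<lambda>i. R ! i) (\<lambda>i. R ! Suc i)"
    using 4 unfolding n_def R_def by simp
  have Rset: "v \<in> path_image (polygonal_path R)" if v: "v \<in> set R" for v
  proof -
    obtain k where k: "k < length R" "v = R ! k"
      using v by (auto simp: in_set_conv_nth)
    show ?thesis
    proof (cases "k < n")
      case True
      then show ?thesis using k im by auto
    next
      case False
      then have "k - 1 < n" "k = Suc (k - 1)" using k R by (auto simp: n_def)
      then show ?thesis using k im by (metis UN_I ends_in_segment(2) lessThan_iff)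
    qed
  qed
  have eq: "arc (polygonal_path (a # R)) \<longleftrightarrow> a \<noteq> b \<and> arc (polygonal_path R) \<and>
      closed_segment a b \<inter> path_image (polygonal_path R) \<subseteq> {b}"
    using R by (subst polygonal_path_Cons) (auto simp: arc_join_eq arc_linepath_iff simp del: linepath_refl)
  have "arc (polygonal_path (a # R)) \<longleftrightarrow>
    distinct (a # R) \<and> disjoint_edges (Suc n) (\<lambda>i. (a # R) ! i) (\<lambda>i. (a # R) ! Suc i)"
  proof
    assume "arc (polygonal_path (a # R))"
    then have *: "a \<noteq> b" "arc (polygonal_path R)"
      "closed_segment a b \<inter> path_image (polygonal_path R) \<subseteq> {b}"
      using eq by auto
    have "a \<notin> set R"
      using Rset[of a] * by auto
    \<comment> \<open>A contact with the new edge could only be \<open>b\<close>, and a vertex of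
      \<open>R\<close> never lies inside an edge of \<open>R\<close>.\<close>
    moreover have "open_segment (R ! j) (R ! Suc j) \<inter> closed_segment a b = {}" if "j < n" for j
    proof -
      have "b \<notin> open_segment (R ! j) (R ! Suc j)"
        using disjoint_edges_vertex[of R b j] IH *(2) R that by (auto simp: n_def R_def)
      moreover have "open_segment (R ! j) (R ! Suc j) \<subseteq> path_image (polygonal_path R)"
        using that im by (auto simp: open_segment_def)
      ultimately show ?thesis using * by blast
    qed
    moreover have "open_segment a b \<inter> closed_segment (R ! j) (R ! Suc j) = {}" if "j < n" for j
      using * that im by (auto simp: open_segment_def)
    ultimately show "distinct (a # R) \<and> disjoint_edges (Suc n) (\<lambda>i. (a # R) ! i) (\<lambda>i. (a # R) ! Suc i)"
      using IH * R by (auto simp: disjoint_edges_Suc)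
  next
    assume "distinct (a # R) \<and> disjoint_edges (Suc n) (\<lambda>i. (a # R) ! i) (\<lambda>i. (a # R) ! Suc i)"
    then have d: "distinct (a # R)" and e: "disjoint_edges n (\<lambda>i. R ! i) (\<lambda>i. R ! Suc i)"
      and 0: "\<And>j. j < n \<Longrightarrow> open_segment a b \<inter> closed_segment (R ! j) (R ! Suc j) = {}"
      and 1: "\<And>j. j < n \<Longrightarrow> open_segment (R ! j) (R ! Suc j) \<inter> closed_segment a b = {}"
      by (auto simp: disjoint_edges_Suc R)
    \<comment> \<open>A contact other than \<open>b\<close> must be \<open>a\<close>, because the
      open new edge is free of contacts. Then \<open>a\<close> lies inside an old edge, against
      disjointness, or is a vertex of \<open>R\<close>, against distinctness.\<close>
    have "x = b" if "x \<in> closed_segment a b" "j < n" "x \<in> closed_segment (R ! j) (R ! Suc j)" for x j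
    proof (rule ccontr)
      assume "x \<noteq> b"
      with that 0[of j] have "x = a" by (auto simp: open_segment_def)
      moreover have "R ! j \<in> set R" "R ! Suc j \<in> set R"
        using that by (auto simp: n_def)
      ultimately show False
        using 1[of j] that d by (auto simp: open_segment_def)
    qed
    then show "arc (polygonal_path (a # R))"
      using eq IH d e R im by (auto simp: hd_in_set[of R, unfolded R])
  qed
  then show ?case
    using n by (simp add: R_def)
qed (auto simp: disjoint_edges_def arc_linepath_iff simp del: linepath_refl)

lemma closed_polygonal_path_nth:
  assumes "i < length vs"
  shows "(vs @ [hd vs]) ! i = vs ! i" "(vs @ [hd vs]) ! Suc i = vs ! ((i + 1) mod length vs)"
proof -
  show "(vs @ [hd vs]) ! i = vs ! i" using assms by (simp add: nth_append)
  show "(vs @ [hd vs]) ! Suc i = vs ! ((i + 1) mod length vs)"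
  proof (cases "Suc i < length vs")
    case False
    then have "Suc i = length vs" using assms by simp
    then show ?thesis by (cases vs) (auto simp: nth_append)
  qed (simp add: nth_append)
qed

abbreviation edge_end :: "complex list \<Rightarrow> nat \<Rightarrow> complex"
  where "edge_end vs i \<equiv> vs ! ((i + 1) mod length vs)"

lemma path_image_closed_polygonal_path:
  assumes "vs \<noteq> []"
  shows "path_image (closed_polygonal_path vs) =
    (\<Union>i<length vs. closed_segment (vs ! i) (edge_end vs i))"
  unfolding closed_polygonal_path_def using assms
  by (subst path_image_polygonal_path) (auto simp: closed_polygonal_path_nth Suc_leI)

lemma winding_number_closed_polygonal_path:
  assumes "vs \<noteq> []" "z \<notin> path_image (closed_polygonal_path vs)"
  shows "winding_number (closed_polygonal_path vs) z =
    (\<Sum>i<length vs. winding_number (linepath (vs ! i) (edge_end vs i)) z)"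
  using assms unfolding closed_polygonal_path_def
  by (subst winding_number_polygonal_path) (auto simp: closed_polygonal_path_nth Suc_leI)

lemma closed_polygonal_path_ends [simp]:
  "vs \<noteq> [] \<Longrightarrow> pathstart (closed_polygonal_path vs) = hd vs"
  "vs \<noteq> [] \<Longrightarrow> pathfinish (closed_polygonal_path vs) = hd vs"
  by (auto simp: closed_polygonal_path_def)

text \<open>Unlike the definition, this criterion is visibly invariant under reversing \<open>vs\<close>.\<close>

lemma simple_closed_polygonal_path_iff:
  assumes "length vs \<ge> 3"
  shows "simple_path (closed_polygonal_path vs) \<longleftrightarrow>
    distinct vs \<and> disjoint_edges (length vs) (\<lambda>i. vs ! i) (edge_end vs)"
proof -
  obtain a R where vs: "vs = a # R" and lR: "length R \<ge> 2"
    using assms by (cases vs) auto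
  define S where "S = R @ [a]"
  define n where "n = length R"
  define b where "b = hd R"
  have S: "length S \<ge> 2" "S \<noteq> []" "hd S = b" "last S = a" "S ! 0 = b" "length S - 1 = n"
      "b \<in> set S" "a \<in> set S"
    using lR by (cases R; auto simp: S_def b_def n_def)+
  have nth: "vs ! i = (a # S) ! i" "edge_end vs i = (a # S) ! Suc i" if "i < Suc n" for i
    using closed_polygonal_path_nth[of i vs] that by (auto simp: vs S_def n_def)
  have de: "disjoint_edges (length vs) (\<lambda>i. vs ! i) (edge_end vs) \<longleftrightarrow>
      disjoint_edges (Suc n) (\<lambda>i. (a # S) ! i) (\<lambda>i. (a # S) ! Suc i)"
    unfolding disjoint_edges_def using nth by (simp add: vs n_def)
  have im: "path_image (polygonal_path S) = (\<Union>i<n. closed_segment (S ! i) (S ! Suc i))"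
    using path_image_polygonal_path[of S] S by simp
  have dist: "distinct vs \<longleftrightarrow> distinct S" by (auto simp: vs S_def)
  have ab: "a \<noteq> b" if "distinct S"
  proof -
    have "R \<noteq> []" using lR by auto
    then have "b \<in> set R" by (simp add: b_def)
    then show ?thesis using that by (auto simp: S_def)
  qed
  \<comment> \<open>The loop is the edge from \<open>a\<close> to \<open>b\<close> followed by the
    path \<open>S\<close> from \<open>b\<close> back to \<open>a\<close>, so here the edge may meet
    the arc in both of its ends.\<close>
  have "simple_path (closed_polygonal_path vs) \<longleftrightarrow> a \<noteq> b \<and> arc (polygonal_path S) \<and>
      closed_segment a b \<inter> path_image (polygonal_path S) \<subseteq> {a, b}"
    unfolding closed_polygonal_path_def vs using S
    by (simp add: S_def[symmetric] polygonal_path_Cons simple_path_join_loop_eq arc_linepath_iff)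
  also have "\<dots> \<longleftrightarrow> distinct S \<and> disjoint_edges n (\<lambda>i. S ! i) (\<lambda>i. S ! Suc i) \<and>
      closed_segment a b \<inter> path_image (polygonal_path S) \<subseteq> {a, b}"
    using arc_polygonal_path_iff[of S] S ab by auto
  also have "\<dots> \<longleftrightarrow> distinct S \<and> disjoint_edges (Suc n) (\<lambda>i. (a # S) ! i) (\<lambda>i. (a # S) ! Suc i)"
    (is "?L \<longleftrightarrow> ?R")
  proof
    assume L: ?L
    have "open_segment (S ! j) (S ! Suc j) \<inter> closed_segment a b = {}" if "j < n" for j
    proof -
      have "b \<notin> open_segment (S ! j) (S ! Suc j)" "a \<notin> open_segment (S ! j) (S ! Suc j)"
        using disjoint_edges_vertex[of S _ j] L S that by auto
      moreover have "open_segment (S ! j) (S ! Suc j) \<subseteq> path_image (polygonal_path S)"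
        using that im by (auto simp: open_segment_def)
      ultimately show ?thesis using L by blast
    qed
    moreover have "open_segment a b \<inter> closed_segment (S ! j) (S ! Suc j) = {}" if "j < n" for j
      using L that im by (auto simp: open_segment_def)
    ultimately show ?R using L S by (auto simp: disjoint_edges_Suc)
  next
    assume R: ?R
    then show ?L using S im by (auto simp: disjoint_edges_Suc open_segment_def)
  qed
  finally show ?thesis using dist de by simp
qed


section \<open>The sides of an edge\<close>

text \<open>The determinant of \<open>u\<close> and \<open>w\<close>: positive if \<open>w\<close>
  points to the left of \<open>u\<close>, negative if it points to the right.\<close>

definition cross :: "complex \<Rightarrow> complex \<Rightarrow> real"
  where "cross u w = Re u * Im w - Im u * Re w"

lemma cross_linear [simp]:
  "cross u (v + w) = cross u v + cross u w" "cross u (v - w) = cross u v - cross u w"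
  "cross u (c *\<^sub>R w) = c * cross u w" "cross (c *\<^sub>R u) w = c * cross u w" "cross u u = 0"
  "cross u 0 = 0" "cross u (- w) = - cross u w" "cross (- u) w = - cross u w"
  by (auto simp: cross_def algebra_simps)

lemma cross_eq_0D:
  assumes "cross u w = 0" "u \<noteq> 0"
  obtains s where "w = s *\<^sub>R u"
proof
  have "(Re u)\<^sup>2 + (Im u)\<^sup>2 \<noteq> 0"
    using assms by (auto simp: complex_eq_iff)
  \<comment> \<open>The coefficient of the orthogonal projection of \<open>w\<close> to
    \<open>u\<close>.\<close>
  then show "w = ((Re u * Re w + Im u * Im w) / ((Re u)\<^sup>2 + (Im u)\<^sup>2)) *\<^sub>R u"
    using assms(1) by (auto simp: cross_def complex_eq_iff field_simps power2_eq_square)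
qed

lemma polygon_Jordan:
  assumes "polygon_with_vertices vs P"
  defines "C \<equiv> path_image (closed_polygonal_path vs)"
  shows "vs \<noteq> []" "open (inside C)" "open (outside C)" "frontier (inside C) = C"
    "frontier (outside C) = C" "P = C \<union> inside C" "P = - outside C"
    "simple_path (closed_polygonal_path vs)"
proof -
  show ne: "vs \<noteq> []" and sp: "simple_path (closed_polygonal_path vs)" and P: "P = C \<union> inside C"
    using assms by (auto simp: polygon_with_vertices_def)
  show "open (inside C)" "open (outside C)" "frontier (inside C) = C" "frontier (outside C) = C"
    using Jordan_inside_outside[OF sp] ne by (auto simp: C_def)
  show "P = - outside C"
    using P inside_Un_outside[of C] inside_Int_outside[of C] by blast
qed

lemma frontier_polygon:
  assumes "polygon_with_vertices vs P"
  shows "frontier P = path_image (closed_polygonal_path vs)"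
  using polygon_Jordan(5,7)[OF assms] by (metis frontier_complement)

text \<open>Moving across an edge changes its contribution to the winding number by less than 1,
  while the contributions of the other edges are continuous. As the winding number takes only
  the values 0 and 1, and both occur nearby, the value 1 is taken on the left.\<close>

lemma counterclockwise_edge_sides:
  assumes P: "polygon_with_vertices vs P" and ccw: "counterclockwise vs" and i: "i < length vs"
    and x: "x \<in> open_segment (vs ! i) (edge_end vs i)"
  defines "C \<equiv> path_image (closed_polygonal_path vs)" and "u \<equiv> edge_end vs i - vs ! i"
  obtains e where "e > 0" "\<And>z. dist z x < e \<Longrightarrow> cross u (z - x) > 0 \<Longrightarrow> z \<in> inside C"
    "\<And>z. dist z x < e \<Longrightarrow> cross u (z - x) < 0 \<Longrightarrow> z \<in> outside C"
proof -
  note J = polygon_Jordan[OF P, folded C_def]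
  define a where "a = vs ! i"
  define b where "b = edge_end vs i"
  have ab: "a \<noteq> b" and u: "u = b - a" "u \<noteq> 0"
    using x by (auto simp: a_def b_def u_def)
  obtain t where t: "0 < t" "t < 1" "x = a + t *\<^sub>R u"
    using x by (auto simp: in_segment a_def b_def u_def algebra_simps)
  define J' where "J' = {..<length vs} - {i}"
  define D where "D = (\<Union>j\<in>J'. closed_segment (vs ! j) (edge_end vs j))"
  have CD: "C = closed_segment a b \<union> D"
    unfolding C_def path_image_closed_polygonal_path[OF J(1)] D_def J'_def a_def b_def
    using i by blast
  have "x \<in> C" using CD x by (auto simp: a_def b_def open_segment_def)
  have "disjoint_edges (length vs) (\<lambda>i. vs ! i) (edge_end vs)"
    using simple_closed_polygonal_path_iff[of vs] P by (simp add: polygon_with_vertices_def)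
  then have xD: "x \<notin> closed_segment (vs ! j) (edge_end vs j)" if "j \<in> J'" for j
    using x i that unfolding disjoint_edges_def J'_def by blast
  then have "x \<notin> D" unfolding D_def by blast
  moreover have "closed D" unfolding D_def J'_def by auto
  ultimately obtain r where r: "r > 0" "\<And>z. dist z x < r \<Longrightarrow> z \<notin> D"
    by (metis closed_approachable dist_commute not_le order_le_less_trans open_Compl openE mem_ball ComplD ComplI subsetD)
  define h where "h j z = Re (winding_number (linepath (vs ! j) (edge_end vs j)) z)" for j z
  define c where "c z = (\<Sum>j\<in>J'. h j z)" for z
  have "isCont c x"
    unfolding c_def h_def
    using xD by (intro continuous_intros continuous_at_winding_number isCont_Re) auto
  \<comment> \<open>With 1/8, two nearby values of \<open>c\<close> differ by less than 1/4. On one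
    side of the edge \<open>h i\<close> keeps its sign and stays below 1/2 in absolute value, so
    \<open>W\<close> changes by less than 3/4 there, too little to pass between 0 and 1.\<close>
  then obtain e0 where e0: "e0 > 0" "\<And>z. dist z x < e0 \<Longrightarrow> dist (c z) (c x) < 1/8"
    unfolding continuous_at_eps_delta by (metis zero_less_divide_1_iff zero_less_numeral)
  \<comment> \<open>The bound \<open>r\<close> keeps the disc off the other edges; the last two
    terms keep it away from the ends, so that it meets the line of the edge only in points of the
    edge.\<close>
  define e where "e = Min {r, e0, t * norm u, (1 - t) * norm u}"
  have e: "e > 0" "e \<le> r" "e \<le> e0" "e \<le> t * norm u" "e \<le> (1 - t) * norm u"
    using r e0 t u by (auto simp: e_def)
  have seg0: "cross u (z - x) = 0" if z: "z \<in> closed_segment a b" for z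
  proof -
    obtain s where "z = (1 - s) *\<^sub>R a + s *\<^sub>R b" using z unfolding in_segment by blast
    then have "z = a + s *\<^sub>R u" by (simp add: u algebra_simps)
    then have "z - x = (s - t) *\<^sub>R u" using t by (simp add: algebra_simps)
    then show ?thesis by simp
  qed
  have C0: "z \<in> C \<longleftrightarrow> cross u (z - x) = 0" if z: "dist z x < e" for z
  proof
    assume "z \<in> C"
    then show "cross u (z - x) = 0" using seg0 CD r(2)[of z] z e by auto
  next
    assume "cross u (z - x) = 0"
    then obtain s where s: "z - x = s *\<^sub>R u" using cross_eq_0D u by blast
    then have "\<bar>s\<bar> * norm u < e" using z by (simp add: dist_norm)
    then have "\<bar>s\<bar> * norm u < t * norm u" "\<bar>s\<bar> * norm u < (1 - t) * norm u" using e by auto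
    then have "\<bar>s\<bar> < t" "\<bar>s\<bar> < 1 - t" using u by auto
    moreover have "z = a + (t + s) *\<^sub>R u" using s t by (simp add: algebra_simps)
    ultimately have "z \<in> closed_segment a b"
      unfolding in_segment u by (intro exI[of _ "t + s"]) (auto simp: algebra_simps)
    then show "z \<in> C" using CD by auto
  qed
  define W where "W z = Re (winding_number (closed_polygonal_path vs) z)" for z
  have W: "W z = h i z + c z" if "z \<notin> C" for z
  proof -
    have "W z = (\<Sum>j<length vs. h j z)"
      unfolding W_def h_def using winding_number_closed_polygonal_path[OF J(1)] that
      by (simp add: C_def)
    also have "\<dots> = h i z + c z"
      unfolding c_def J'_def using i by (subst sum.remove[of _ i]) auto
    finally show ?thesis .
  qed
  have Win: "W z = 1" if "z \<in> inside C" for z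
    using ccw that by (auto simp: counterclockwise_def W_def C_def)
  have Wout: "W z = 0" if "z \<in> outside C" for z
    using winding_number_zero_in_outside[of "closed_polygonal_path vs" z] that J(1)
    by (simp add: W_def C_def closed_polygonal_path_def)
  have io: "z \<in> inside C \<or> z \<in> outside C" if "z \<notin> C" for z
    using inside_Un_outside[of C] that by blast
  have bx: "b - z = (1 - t) *\<^sub>R u - (z - x)" "a - z = - t *\<^sub>R u - (z - x)" for z
    using t u by (auto simp: algebra_simps)
  \<comment> \<open>The sign criteria for the winding number of a segment are stated with
    \<open>Im (u * cnj y)\<close>; this translates them into sides of the edge.\<close>
  have crossIm: "Im (u * cnj y) = - cross u y" for y
    by (simp add: cross_def)
  have hpos: "0 < h i z" if "cross u (z - x) > 0" for z
  proof -
    have "Im (u * cnj (b - z)) > 0" unfolding crossIm bx using that by simp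
    then show ?thesis
      using winding_number_linepath_pos_lt[of b a z] by (simp add: h_def a_def b_def u)
  qed
  have hneg: "h i z < 0" if "cross u (z - x) < 0" for z
  proof -
    have "Im (- u * cnj (a - z)) > 0" unfolding mult_minus_left uminus_complex.sel crossIm bx using that by simp
    then show ?thesis
      using winding_number_linepath_neg_lt[of a b z] by (simp add: h_def a_def b_def u)
  qed
  have hhalf: "\<bar>h i z\<bar> < 1/2" if "cross u (z - x) \<noteq> 0" for z
    using winding_number_lt_half_linepath[of z a b] seg0[of z] that by (auto simp: h_def a_def b_def)
  have cc: "\<bar>c z - c z'\<bar> < 1/4" if "dist z x < e" "dist z' x < e" for z z'
  proof -
    have "dist (c z) (c x) < 1/8" "dist (c z') (c x) < 1/8"
      using that e(3) e0(2)[of z] e0(2)[of z'] by linarith+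
    then show ?thesis unfolding dist_real_def by linarith
  qed
  obtain z1 where z1: "z1 \<in> inside C" "dist z1 x < e"
    using \<open>x \<in> C\<close> J(4) e(1) by (metis Diff_iff closure_approachable frontier_def)
  obtain z0 where z0: "z0 \<in> outside C" "dist z0 x < e"
    using \<open>x \<in> C\<close> J(5) e(1) by (metis Diff_iff closure_approachable frontier_def)
  have z01: "z0 \<notin> C" "z1 \<notin> C"
    using z0 z1 inside_no_overlap[of C] outside_no_overlap[of C] by blast+
  have W01: "W z = 0 \<or> W z = 1" if "z \<notin> C" for z
    using io[OF that] Win Wout by auto
  have same: "W z = W z'"
    if "dist z x < e" "dist z' x < e" "cross u (z - x) * cross u (z' - x) > 0" for z z'
  proof -
    have n: "z \<notin> C" "z' \<notin> C" using that C0 by auto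
    have "\<bar>h i z - h i z'\<bar> < 1/2"
    proof (cases "cross u (z - x) > 0")
      case True
      then have "cross u (z' - x) > 0" using that(3) by (simp add: zero_less_mult_iff)
      with True have "0 < h i z" "0 < h i z'" "\<bar>h i z\<bar> < 1/2" "\<bar>h i z'\<bar> < 1/2"
        using hpos[of z] hpos[of z'] hhalf[of z] hhalf[of z'] by (auto simp del: cross_linear)
      then show ?thesis by linarith
    next
      case False
      then have "cross u (z - x) < 0" "cross u (z' - x) < 0"
        using that(3) by (auto simp: zero_less_mult_iff)
      then have "h i z < 0" "h i z' < 0" "\<bar>h i z\<bar> < 1/2" "\<bar>h i z'\<bar> < 1/2"
        using hneg[of z] hneg[of z'] hhalf[of z] hhalf[of z'] by (auto simp del: cross_linear)
      then show ?thesis by linarith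
    qed
    then show ?thesis
      using W[OF n(1)] W[OF n(2)] W01[OF n(1)] W01[OF n(2)] cc[OF that(1,2)] by linarith
  qed
  have s0: "cross u (z0 - x) \<noteq> 0" "cross u (z1 - x) \<noteq> 0"
    using C0 z0 z1 z01 by auto
  have "\<not> cross u (z0 - x) * cross u (z1 - x) > 0"
    using same[of z0 z1] z0 z1 Win[of z1] Wout[of z0] by auto
  \<comment> \<open>In this arrangement \<open>W\<close> would rise by 1 from \<open>z0\<close> to
    \<open>z1\<close> while \<open>h i\<close> falls and \<open>c\<close> changes by less than
    1/4.\<close>
  moreover have "\<not> (cross u (z0 - x) > 0 \<and> cross u (z1 - x) < 0)"
    using hpos[of z0] hneg[of z1] W[of z0] W[of z1] z01 cc[OF z0(2) z1(2)] Win[OF z1(1)] Wout[OF z0(1)]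
    by auto
  ultimately have s: "cross u (z0 - x) < 0" "cross u (z1 - x) > 0"
    using s0 by (auto simp: zero_less_mult_iff)
  show thesis
  proof (rule that[OF e(1)])
    fix z assume z: "dist z x < e" "cross u (z - x) > 0"
    then have "W z = 1" using same[of z z1] z1 s Win by auto
    then show "z \<in> inside C" using Wout[of z] io[of z] C0[OF z(1)] z(2) by auto
  next
    fix z assume z: "dist z x < e" "cross u (z - x) < 0"
    then have "W z = 0" using same[of z z0] z0 s Wout by (auto simp: zero_less_mult_iff)
    then show "z \<in> outside C" using Win[of z] io[of z] C0[OF z(1)] z(2) by auto
  qed
qed

section \<open>Reversing the vertex list\<close>

text \<open>Edge \<open>i\<close> of the reversed list is edge \<open>rev_index n i\<close> of the
  original list, run backwards. The closing edge \<open>n - 1\<close> remains the closing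
  edge.\<close>

definition rev_index :: "nat \<Rightarrow> nat \<Rightarrow> nat"
  where "rev_index n i = (if i < n - 1 then n - 2 - i else n - 1)"

lemma rev_index_less: "i < n \<Longrightarrow> rev_index n i < n"
  and rev_index_rev_index: "i < n \<Longrightarrow> rev_index n (rev_index n i) = i"
  by (auto simp: rev_index_def)

lemma rev_index_Suc: "i < n \<Longrightarrow> (rev_index n ((i + 1) mod n) + 1) mod n = rev_index n i"
  by (cases "Suc i = n"; cases "Suc (Suc i) = n") (auto simp: rev_index_def mod_Suc Suc_diff_Suc)

lemma rev_edge:
  assumes "i < length vs"
  shows "rev vs ! i = edge_end vs (rev_index (length vs) i)"
    "edge_end (rev vs) i = vs ! rev_index (length vs) i"
proof -
  show "rev vs ! i = edge_end vs (rev_index (length vs) i)"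
  proof (cases "Suc i = length vs")
    case True
    then have "i = length vs - 1" "length vs - 1 + 1 = length vs" by auto
    then show ?thesis using assms by (simp add: rev_index_def rev_nth)
  qed (use assms in \<open>auto simp: rev_index_def rev_nth Suc_diff_Suc\<close>)
  show "edge_end (rev vs) i = vs ! rev_index (length vs) i"
  proof (cases "Suc i = length vs")
    case True
    then have "0 < length vs" by linarith
    with True show ?thesis by (simp add: rev_index_def rev_nth[of 0])
  qed (use assms in \<open>auto simp: rev_index_def rev_nth\<close>)
qed

lemma closed_segment_rev_edge:
  assumes "i < length vs"
  shows "closed_segment (rev vs ! i) (edge_end (rev vs) i) =
    closed_segment (vs ! rev_index (length vs) i) (edge_end vs (rev_index (length vs) i))"
  unfolding rev_edge[OF assms] by (rule closed_segment_commute)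

lemma bij_betw_rev_index: "bij_betw (rev_index n) {..<n} {..<n}"
  by (rule bij_betw_byWitness[where f' = "rev_index n"])
    (auto simp: rev_index_less rev_index_rev_index)

lemma path_image_closed_polygonal_path_rev:
  assumes "vs \<noteq> []"
  shows "path_image (closed_polygonal_path (rev vs)) = path_image (closed_polygonal_path vs)"
proof -
  have "path_image (closed_polygonal_path (rev vs)) =
      (\<Union>i<length vs. closed_segment (vs ! rev_index (length vs) i) (edge_end vs (rev_index (length vs) i)))"
    using assms closed_segment_rev_edge[of _ vs]
    by (subst path_image_closed_polygonal_path) (auto simp del: closed_segment_eq)
  also have "\<dots> = (\<Union>i\<in>rev_index (length vs) ` {..<length vs}. closed_segment (vs ! i) (edge_end vs i))"
    by simp
  also have "rev_index (length vs) ` {..<length vs} = {..<length vs}"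
    using bij_betw_rev_index by (rule bij_betw_imp_surj_on)
  finally show ?thesis using assms by (simp add: path_image_closed_polygonal_path)
qed

text \<open>The path of the reversed list starts at the last vertex, so it is not the
  \<open>reversepath\<close> of the original one; the sign change is obtained edge by edge
  instead.\<close>

lemma winding_number_closed_polygonal_path_rev:
  assumes "vs \<noteq> []" "z \<notin> path_image (closed_polygonal_path vs)"
  shows "winding_number (closed_polygonal_path (rev vs)) z =
    - winding_number (closed_polygonal_path vs) z"
proof -
  let ?n = "length vs"
  have "winding_number (closed_polygonal_path (rev vs)) z =
      (\<Sum>i<?n. winding_number (linepath (rev vs ! i) (edge_end (rev vs) i)) z)"
    using assms winding_number_closed_polygonal_path[of "rev vs" z]
    by (simp add: path_image_closed_polygonal_path_rev)
  also have "\<dots> = (\<Sum>i<?n. - winding_number (linepath (vs ! rev_index ?n i) (edge_end vs (rev_index ?n i))) z)"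
  proof (rule sum.cong)
    fix i assume "i \<in> {..<?n}"
    then have i: "i < ?n" by simp
    have "z \<notin> closed_segment (vs ! rev_index ?n i) (edge_end vs (rev_index ?n i))"
      using assms rev_index_less[OF i] by (auto simp: path_image_closed_polygonal_path)
    then have "winding_number (reversepath (linepath (vs ! rev_index ?n i) (edge_end vs (rev_index ?n i)))) z
      = - winding_number (linepath (vs ! rev_index ?n i) (edge_end vs (rev_index ?n i))) z"
      by (intro winding_number_reversepath) auto
    then show "winding_number (linepath (rev vs ! i) (edge_end (rev vs) i)) z =
        - winding_number (linepath (vs ! rev_index ?n i) (edge_end vs (rev_index ?n i))) z"
      unfolding rev_edge[OF i] by (simp only: reversepath_linepath)
  qed simp
  also have "\<dots> = - (\<Sum>i<?n. winding_number (linepath (vs ! i) (edge_end vs i)) z)"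
    unfolding sum_negf
    by (subst sum.reindex_bij_betw[OF bij_betw_rev_index]) simp
  finally show ?thesis using assms by (simp add: winding_number_closed_polygonal_path)
qed

lemma polygon_with_vertices_rev:
  assumes "polygon_with_vertices vs P"
  shows "polygon_with_vertices (rev vs) P"
proof -
  let ?n = "length vs"
  have n: "3 \<le> ?n" "vs \<noteq> []" and P: "P = path_image (closed_polygonal_path vs) \<union> inside (path_image (closed_polygonal_path vs))"
    and col: "\<And>i. i < ?n \<Longrightarrow> \<not> collinear {vs ! i, vs ! ((i + 1) mod ?n), vs ! ((i + 2) mod ?n)}"
    and "simple_path (closed_polygonal_path vs)"
    using assms unfolding polygon_with_vertices_def by auto
  then have d: "distinct vs" and de: "disjoint_edges ?n (\<lambda>i. vs ! i) (edge_end vs)"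
    using simple_closed_polygonal_path_iff[OF n(1)] by auto
  have "disjoint_edges ?n (\<lambda>i. rev vs ! i) (edge_end (rev vs))"
    unfolding disjoint_edges_def
  proof (intro allI impI)
    fix i j assume ij: "i < ?n" "j < ?n" "i \<noteq> j"
    then have "rev_index ?n i \<noteq> rev_index ?n j" by (metis rev_index_rev_index)
    with ij de rev_index_less[of i ?n] rev_index_less[of j ?n]
    show "open_segment (rev vs ! i) (edge_end (rev vs) i) \<inter> closed_segment (rev vs ! j) (edge_end (rev vs) j) = {}"
      unfolding disjoint_edges_def rev_edge[OF ij(1)] rev_edge[OF ij(2)]
      by (metis closed_segment_commute open_segment_commute)
  qed
  then have "simple_path (closed_polygonal_path (rev vs))"
    using simple_closed_polygonal_path_iff[of "rev vs"] n d by simp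
  moreover have "\<not> collinear {rev vs ! i, rev vs ! ((i + 1) mod ?n), rev vs ! ((i + 2) mod ?n)}"
    if i: "i < ?n" for i
  proof -
    define j where "j = (i + 1) mod ?n"
    have j: "j < ?n" using n by (auto simp: j_def)
    \<comment> \<open>Three consecutive vertices of the reversed list, read backwards, are the three
      consecutive vertices of the original list that start at \<open>k\<close>.\<close>
    define k where "k = rev_index ?n j"
    have k: "k < ?n" using j rev_index_less by (simp add: k_def)
    have ki: "(k + 1) mod ?n = rev_index ?n i"
      using rev_index_Suc[OF i] by (simp add: k_def j_def)
    have "rev vs ! i = vs ! ((k + 2) mod ?n)"
      unfolding rev_edge(1)[OF i] ki[symmetric] by (simp add: mod_simps)
    moreover have "rev vs ! j = vs ! ((k + 1) mod ?n)"
      unfolding rev_edge(1)[OF j] k_def ..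
    moreover have "rev vs ! ((i + 2) mod ?n) = vs ! k"
      using rev_edge(2)[OF j] unfolding k_def by (simp add: j_def mod_simps)
    ultimately show ?thesis
      using col[OF k] by (simp add: j_def insert_commute)
  qed
  ultimately show ?thesis
    unfolding polygon_with_vertices_def using n P by (simp add: path_image_closed_polygonal_path_rev)
qed

text \<open>The winding number of a simple closed curve is 1 throughout its inside or -1 throughout;
  in the second case the reversed list serves.\<close>

lemma counterclockwise_vertices:
  assumes "polygon_with_vertices vs P"
  obtains us where "polygon_with_vertices us P" "counterclockwise us" "set us = set vs"
proof -
  note J = polygon_Jordan[OF assms]
  consider "counterclockwise vs" | "\<And>z. z \<in> inside (path_image (closed_polygonal_path vs)) \<Longrightarrow>
      winding_number (closed_polygonal_path vs) z = -1"
    using simple_closed_path_winding_number_inside[OF J(8)] unfolding counterclockwise_def by metis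
  then show thesis
  proof cases
    case 1
    then show ?thesis using assms that by blast
  next
    case 2
    have "counterclockwise (rev vs)"
      unfolding counterclockwise_def path_image_closed_polygonal_path_rev[OF J(1)]
    proof
      fix z assume z: "z \<in> inside (path_image (closed_polygonal_path vs))"
      then have "z \<notin> path_image (closed_polygonal_path vs)"
        using inside_no_overlap by blast
      then show "winding_number (closed_polygonal_path (rev vs)) z = 1"
        using winding_number_closed_polygonal_path_rev[OF J(1)] 2[OF z] by simp
    qed
    then show ?thesis using that[of "rev vs"] polygon_with_vertices_rev[OF assms] by simp
  qed
qed

section \<open>Linear images of polygons\<close>

text \<open>A linear bijection carries components of the complement to components and preserves
  boundedness. One inclusion is shown for every linear bijection; applied to the inverse it gives
  the other.\<close>

lemma inside_bij_linear_image:
  fixes f :: "'a::euclidean_space \<Rightarrow> 'a"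
  assumes f: "linear f" "bij f"
  shows "inside (f ` S) = f ` inside S"
proof -
  have *: "f x \<in> inside (f ` S)" if f: "linear f" "bij f" and x: "x \<in> inside S"
    for f :: "'a \<Rightarrow> 'a" and x S
  proof -
    have "connected_component_set (- (f ` S)) (f x) \<subseteq> f ` connected_component_set (- S) x"
    proof
      fix y assume "y \<in> connected_component_set (- (f ` S)) (f x)"
      then obtain T where T: "connected T" "T \<subseteq> - (f ` S)" "f x \<in> T" "y \<in> T"
        by (auto simp: connected_component_def)
      define g where "g = inv f"
      have g: "linear g" "\<And>z. f (g z) = z" "\<And>z. g (f z) = z"
        using f by (auto simp: g_def bij_is_inj bij_is_surj surj_f_inv_f
            intro: inj_linear_imp_inv_linear)
      have "connected (g ` T)"
        using T(1) g(1) by (intro connected_continuous_image linear_continuous_on) (auto simp: linear_linear)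
      moreover have "g ` T \<subseteq> - S" "x \<in> g ` T" "g y \<in> g ` T"
        using T g by (auto simp: image_iff) (metis ComplD imageI subsetD, metis)
      ultimately have "g y \<in> connected_component_set (- S) x"
        by (auto simp: connected_component_def)
      then show "y \<in> f ` connected_component_set (- S) x"
        using g by (metis imageI)
    qed
    moreover have "bounded (f ` connected_component_set (- S) x)"
      using x f by (auto simp: inside_def linear_linear intro: bounded_linear_image)
    ultimately show ?thesis
      using x f by (auto simp: inside_def bij_is_inj inj_image_mem_iff intro: bounded_subset)
  qed
  define g where "g = inv f"
  have g: "linear g" "bij g" "\<And>z. f (g z) = z" "\<And>z. g (f z) = z"
    using f by (auto simp: g_def bij_is_inj bij_is_surj surj_f_inv_f bij_imp_bij_inv
        intro: inj_linear_imp_inv_linear)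
  show ?thesis
  proof
    show "f ` inside S \<subseteq> inside (f ` S)" using *[OF f] by blast
    show "inside (f ` S) \<subseteq> f ` inside S"
    proof
      fix y assume "y \<in> inside (f ` S)"
      then have "g y \<in> inside (g ` f ` S)" by (rule *[OF g(1,2)])
      then have "g y \<in> inside S" using g by (simp add: image_image)
      then show "y \<in> f ` inside S" using g by (metis imageI)
    qed
  qed
qed

text \<open>Needed for the dilations in \<open>denominator\<close>. Simplicity is transported
  through the criterion on edges, as injective linear maps respect segments and
  intersections.\<close>

lemma polygon_with_vertices_linear_image:
  assumes f: "linear f" "bij f" and "polygon_with_vertices vs P"
  shows "polygon_with_vertices (map f vs) (f ` P)"
proof -
  let ?n = "length vs"
  have n: "3 \<le> ?n" "vs \<noteq> []" and P: "P = path_image (closed_polygonal_path vs) \<union> inside (path_image (closed_polygonal_path vs))"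
    and col: "\<And>i. i < ?n \<Longrightarrow> \<not> collinear {vs ! i, vs ! ((i + 1) mod ?n), vs ! ((i + 2) mod ?n)}"
    and "simple_path (closed_polygonal_path vs)"
    using assms unfolding polygon_with_vertices_def by auto
  then have d: "distinct vs" and de: "disjoint_edges ?n (\<lambda>i. vs ! i) (edge_end vs)"
    using simple_closed_polygonal_path_iff[OF n(1)] by auto
  have inj: "inj f" using f by (simp add: bij_is_inj)
  have nth: "map f vs ! i = f (vs ! i)" "edge_end (map f vs) i = f (edge_end vs i)"
    "map f vs ! ((i + 2) mod ?n) = f (vs ! ((i + 2) mod ?n))" if "i < ?n" for i
    using that n by (auto intro: nth_map)
  have "disjoint_edges ?n (\<lambda>i. map f vs ! i) (edge_end (map f vs))"
    using de inj unfolding disjoint_edges_def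
    by (simp only: nth open_segment_linear_image[OF f(1) inj] closed_segment_linear_image[OF f(1)]
        image_Int[OF inj, symmetric] image_is_empty simp_thms cong: imp_cong)
  moreover have "distinct (map f vs)" using d inj by (simp add: distinct_map inj_on_def)
  ultimately have "simple_path (closed_polygonal_path (map f vs))"
    using simple_closed_polygonal_path_iff[of "map f vs"] n by simp
  moreover have "\<not> collinear {map f vs ! i, edge_end (map f vs) i, map f vs ! ((i + 2) mod ?n)}"
    if "i < ?n" for i
    using col[OF that] unfolding nth[OF that] collinear_3_expand inj_eq[OF inj]
      linear_add[OF f(1), symmetric] linear_scale[OF f(1), symmetric] .
  moreover have im: "path_image (closed_polygonal_path (map f vs)) = f ` path_image (closed_polygonal_path vs)"
  proof -
    have "path_image (closed_polygonal_path (map f vs)) =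
        (\<Union>i<?n. closed_segment (map f vs ! i) (edge_end (map f vs) i))"
      using path_image_closed_polygonal_path[of "map f vs"] n by simp
    also have "\<dots> = (\<Union>i<?n. f ` closed_segment (vs ! i) (edge_end vs i))"
      using nth closed_segment_linear_image[OF f(1)] by (intro SUP_cong) auto
    finally show ?thesis
      using path_image_closed_polygonal_path[OF n(2)] by (simp add: image_UN)
  qed
  ultimately show ?thesis
    unfolding polygon_with_vertices_def P inside_bij_linear_image[OF f, symmetric] im image_Un
    using n by simp
qed

section \<open>Germs on the right of a segment\<close>

text \<open>Tested on each ray strictly to the right of \<open>u\<close>, with a radius that may
  depend on the ray. The sets with this property still form a proper filter when \<open>u\<close> is
  nonzero, and affine maps transport it without estimates.\<close>

definition right_germ :: "complex set \<Rightarrow> complex \<Rightarrow> complex \<Rightarrow> bool"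
  where "right_germ S x u \<longleftrightarrow>
    (\<forall>w. cross u w < 0 \<longrightarrow> (\<forall>\<^sub>F e in at_right (0::real). x + e *\<^sub>R w \<in> S))"

lemma right_germ_mono: "right_germ S x u \<Longrightarrow> S \<subseteq> T \<Longrightarrow> right_germ T x u"
  unfolding right_germ_def by (auto elim!: eventually_mono)

lemma right_germ_Int: "right_germ (S \<inter> T) x u \<longleftrightarrow> right_germ S x u \<and> right_germ T x u"
  unfolding right_germ_def by (auto simp: eventually_conj_iff)

lemma not_right_germ_empty:
  assumes "u \<noteq> 0"
  shows "\<not> right_germ {} x u"
proof -
  \<comment> \<open>\<open>u\<close> turned clockwise by a right angle.\<close>
  define w where "w = - \<i> * u"
  have w: "cross u w < 0"
    unfolding w_def
    using assms sum_power2_gt_zero_iff[of "Re u" "Im u"]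
    by (auto simp: cross_def complex_eq_iff power2_eq_square)
  show ?thesis
  proof
    assume "right_germ {} x u"
    then have "\<forall>\<^sub>F e in at_right (0::real). False"
      using w by (auto simp: right_germ_def)
    then show False by simp
  qed
qed

lemma eventually_at_right_scaleR:
  fixes x w :: complex
  assumes "open S" "x \<in> S"
  shows "\<forall>\<^sub>F e in at_right (0::real). x + e *\<^sub>R w \<in> S"
proof -
  have "((\<lambda>e. x + e *\<^sub>R w) \<longlongrightarrow> x + 0 *\<^sub>R w) (at_right (0::real))"
    by (rule tendsto_add[OF tendsto_const tendsto_scaleR[OF tendsto_ident_at tendsto_const]])
  then show ?thesis using assms by (auto dest: topological_tendstoD)
qed

lemma right_germ_open: "open S \<Longrightarrow> x \<in> S \<Longrightarrow> right_germ S x u"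
  by (simp add: right_germ_def eventually_at_right_scaleR)

text \<open>In general neither a set nor its complement contains the germ. The sets for which one of
  them does are closed under complement and intersection, so it is enough to treat half-planes and
  build simplices from them.\<close>

definition decided :: "complex set \<Rightarrow> complex \<Rightarrow> complex \<Rightarrow> bool"
  where "decided S x u \<longleftrightarrow> right_germ S x u \<or> right_germ (- S) x u"

lemma decided_Compl: "decided S x u \<Longrightarrow> decided (- S) x u"
  by (auto simp: decided_def)

lemma decided_Int: "decided S x u \<Longrightarrow> decided T x u \<Longrightarrow> decided (S \<inter> T) x u"
  unfolding decided_def right_germ_Int by (metis Compl_Int right_germ_mono sup_ge1 sup_ge2)

text \<open>If no piece contained the germ, every complement would, hence also their finite
  intersection, which is disjoint from the union.\<close>

lemma right_germ_Union_iff: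
  assumes "u \<noteq> 0" "finite I" "\<And>i. i \<in> I \<Longrightarrow> decided (T i) x u"
  shows "right_germ (\<Union>i\<in>I. T i) x u \<longleftrightarrow> (\<exists>i\<in>I. right_germ (T i) x u)"
proof
  assume R: "right_germ (\<Union>i\<in>I. T i) x u"
  show "\<exists>i\<in>I. right_germ (T i) x u"
  proof (rule ccontr)
    assume "\<not> ?thesis"
    then have "\<forall>i\<in>I. right_germ (- T i) x u" using assms(3) by (auto simp: decided_def)
    then have "right_germ (\<Inter>i\<in>I. - T i) x u"
      using assms(2) unfolding right_germ_def by (auto simp: eventually_ball_finite_distrib)
    then have "right_germ ((\<Inter>i\<in>I. - T i) \<inter> (\<Union>i\<in>I. T i)) x u" using R by (simp add: right_germ_Int)
    moreover have "(\<Inter>i\<in>I. - T i) \<inter> (\<Union>i\<in>I. T i) = {}" by auto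
    ultimately show False using not_right_germ_empty[OF assms(1)] by metis
  qed
next
  assume "\<exists>i\<in>I. right_germ (T i) x u"
  then obtain i where "i \<in> I" "right_germ (T i) x u" by blast
  then show "right_germ (\<Union>i\<in>I. T i) x u" by (elim right_germ_mono) blast
qed

definition sample :: "real \<Rightarrow> complex \<Rightarrow> complex \<Rightarrow> complex"
  where "sample \<theta> p q = p + \<theta> *\<^sub>R (q - p)"

lemma sample_sel: "Re (sample \<theta> p q) = Re p + \<theta> * (Re q - Re p)"
  "Im (sample \<theta> p q) = Im p + \<theta> * (Im q - Im p)"
  by (simp_all add: sample_def)

text \<open>A sample point at an irrational parameter lies on no rational line but the one through
  \<open>p\<close> and \<open>q\<close>.\<close>

lemma rational_affine_sample_eq_0:
  assumes "\<alpha> \<in> \<rat>" "\<beta> \<in> \<rat>" "\<gamma> \<in> \<rat>" and pq: "p \<in> rational_points" "q \<in> rational_points"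
    and \<theta>: "\<theta> \<notin> \<rat>"
    and 0: "\<alpha> * Re (sample \<theta> p q) + \<beta> * Im (sample \<theta> p q) + \<gamma> = 0"
  shows "\<alpha> * Re p + \<beta> * Im p + \<gamma> = 0" "\<alpha> * Re q + \<beta> * Im q + \<gamma> = 0"
proof -
  define f where "f z = \<alpha> * Re z + \<beta> * Im z + \<gamma>" for z
  have f: "f p \<in> \<rat>" "f q \<in> \<rat>"
    using assms by (auto simp: f_def rational_points_def)
  have eq: "f p + \<theta> * (f q - f p) = 0"
    using 0 by (simp add: f_def sample_sel algebra_simps)
  have "f q = f p"
  proof (rule ccontr)
    assume "f q \<noteq> f p"
    then have "\<theta> = - f p / (f q - f p)" using eq by (simp add: field_simps)
    then show False using f \<theta> by (auto intro: Rats_divide Rats_diff Rats_minus_iff[THEN iffD2])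
  qed
  then have "f p = 0" "f q = 0" using eq by auto
  then show "\<alpha> * Re p + \<beta> * Im p + \<gamma> = 0" "\<alpha> * Re q + \<beta> * Im q + \<gamma> = 0"
    by (auto simp: f_def)
qed

text \<open>Off the boundary line a neighbourhood of the sample decides. On it, rationality forces
  \<open>p\<close> and \<open>q\<close> onto the line too, so the affine function has constant sign
  on the right of the segment or vanishes identically.\<close>

lemma decided_halfplane:
  assumes r: "\<alpha> \<in> \<rat>" "\<beta> \<in> \<rat>" "\<gamma> \<in> \<rat>" and pq: "p \<in> rational_points" "q \<in> rational_points" "p \<noteq> q"
    and \<theta>: "\<theta> \<notin> \<rat>"
  shows "decided {z. \<alpha> * Re z + \<beta> * Im z + \<gamma> > 0} (sample \<theta> p q) (q - p)"
proof -
  define x where "x = sample \<theta> p q"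
  define u where "u = q - p"
  define f where "f z = \<alpha> * Re z + \<beta> * Im z + \<gamma>" for z
  have cont: "continuous_on UNIV f" unfolding f_def by (intro continuous_intros)
  consider "f x > 0" | "f x < 0" | "f x = 0" by linarith
  then have "decided {z. f z > 0} x u"
  proof cases
    case 1
    have "open {z. f z > 0}"
      using cont by (intro open_Collect_less) auto
    then show ?thesis using 1 by (auto simp: decided_def intro: right_germ_open)
  next
    case 2
    have "open {z. f z < 0}"
      using cont by (intro open_Collect_less) auto
    then have "right_germ {z. f z < 0} x u" using 2 by (auto intro: right_germ_open)
    then have "right_germ (- {z. f z > 0}) x u" by (rule right_germ_mono) auto
    then show ?thesis by (simp add: decided_def)
  next
    case 3
    have "f p = 0" "f q = 0"
      using rational_affine_sample_eq_0[OF r pq(1,2) \<theta>] 3 by (auto simp: f_def x_def)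
    \<comment> \<open>The function takes equal values at \<open>p\<close> and \<open>q\<close>, so
      its gradient is orthogonal to \<open>u\<close>, that is, parallel to the normal
      \<open>\<i> * u\<close>.\<close>
    then have "cross (\<i> * u) (Complex \<alpha> \<beta>) = 0"
      by (simp add: f_def u_def cross_def algebra_simps)
    moreover have "\<i> * u \<noteq> 0" using pq by (simp add: u_def)
    ultimately obtain l where l: "Complex \<alpha> \<beta> = l *\<^sub>R (\<i> * u)"
      using cross_eq_0D by blast
    have fw: "f (x + e *\<^sub>R w) = e * (l * cross u w)" for e w
    proof -
      have "\<alpha> = - l * Im u" "\<beta> = l * Re u" using l by (auto simp: complex_eq_iff)
      moreover have "f (x + e *\<^sub>R w) = f x + e * (\<alpha> * Re w + \<beta> * Im w)"
        by (simp add: f_def algebra_simps)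
      ultimately show ?thesis using 3 by (simp add: cross_def algebra_simps)
    qed
    have pos: "\<forall>\<^sub>F e in at_right (0::real). e > 0"
      by (simp add: eventually_at_right_less)
    show ?thesis
    proof (cases "l \<ge> 0")
      \<comment> \<open>This includes \<open>l = 0\<close>, where the function vanishes identically
        and the strict inequality holds nowhere.\<close>
      case True
      have "right_germ (- {z. f z > 0}) x u"
        unfolding right_germ_def
      proof (intro allI impI)
        fix w assume "cross u w < 0"
        then have "l * cross u w \<le> 0" using True by (simp add: mult_nonneg_nonpos)
        then show "\<forall>\<^sub>F e in at_right 0. x + e *\<^sub>R w \<in> - {z. f z > 0}"
          by (intro eventually_mono[OF pos]) (auto simp: fw not_less intro: mult_nonneg_nonpos)
      qed
      then show ?thesis by (simp add: decided_def)
    next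
      case False
      have "right_germ {z. f z > 0} x u"
        unfolding right_germ_def
      proof (intro allI impI)
        fix w assume "cross u w < 0"
        then have "l * cross u w > 0" using False by (simp add: mult_neg_neg)
        then show "\<forall>\<^sub>F e in at_right 0. x + e *\<^sub>R w \<in> {z. f z > 0}"
          by (intro eventually_mono[OF pos]) (auto simp: fw)
      qed
      then show ?thesis by (simp add: decided_def)
    qed
  qed
  then show ?thesis by (simp add: f_def x_def u_def)
qed

text \<open>The value is \<open>1\<close> on a boundary segment of \<open>S\<close> with \<open>S\<close> on its left and \<open>0\<close> on the reversed
  segment and away from the boundary.\<close>

definition jump :: "real \<Rightarrow> complex set \<Rightarrow> complex \<times> complex \<Rightarrow> int"
  where "jump \<theta> S = (\<lambda>(p, q). of_bool (sample \<theta> p q \<in> S) - of_bool (right_germ S (sample \<theta> p q) (q - p)))"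

lemma of_bool_unique_ex:
  assumes "finite I" "\<And>i j. i \<in> I \<Longrightarrow> j \<in> I \<Longrightarrow> A i \<Longrightarrow> A j \<Longrightarrow> i = j"
  shows "of_bool (\<exists>i\<in>I. A i) = (\<Sum>i\<in>I. of_bool (A i) :: int)"
proof (cases "\<exists>i\<in>I. A i")
  case True
  then obtain k where k: "k \<in> I" "A k" by blast
  then have "(\<Sum>i\<in>I. of_bool (A i) :: int) = (\<Sum>i\<in>I. if i = k then 1 else 0)"
    using assms(2) by (intro sum.cong) auto
  then show ?thesis using k assms(1) by auto
qed auto

text \<open>At most one disjoint piece contains the sample, and at most one contains the germ, since
  the empty set contains no germ. Both indicators are therefore sums over the pieces.\<close>

lemma jump_Union:
  assumes "p \<noteq> q" "finite I" "disjoint_family_on T I"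
    and dec: "\<And>i. i \<in> I \<Longrightarrow> decided (T i) (sample \<theta> p q) (q - p)"
  shows "jump \<theta> (\<Union>i\<in>I. T i) (p, q) = (\<Sum>i\<in>I. jump \<theta> (T i) (p, q))"
proof -
  define x where "x = sample \<theta> p q"
  have u: "q - p \<noteq> 0" using assms by simp
  have 1: "of_bool (x \<in> (\<Union>i\<in>I. T i)) = (\<Sum>i\<in>I. of_bool (x \<in> T i) :: int)"
  proof -
    have "i = j" if "i \<in> I" "j \<in> I" "x \<in> T i" "x \<in> T j" for i j
      using that assms(3) by (auto simp: disjoint_family_on_def)
    then show ?thesis using of_bool_unique_ex[of I "\<lambda>i. x \<in> T i"] assms(2) by simp
  qed
  have "i = j" if "i \<in> I" "j \<in> I" "right_germ (T i) x (q - p)" "right_germ (T j) x (q - p)" for i j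
  proof (rule ccontr)
    assume "i \<noteq> j"
    then have "T i \<inter> T j = {}" using that assms(3) by (auto simp: disjoint_family_on_def)
    then show False using that right_germ_Int not_right_germ_empty[OF u] by metis
  qed
  then have "of_bool (right_germ (\<Union>i\<in>I. T i) x (q - p)) =
      (\<Sum>i\<in>I. of_bool (right_germ (T i) x (q - p)) :: int)"
    using of_bool_unique_ex[of I "\<lambda>i. right_germ (T i) x (q - p)"] assms(2)
      right_germ_Union_iff[OF u assms(2) dec] by (simp add: x_def)
  with 1 show ?thesis by (simp add: jump_def x_def sum_subtractf)
qed

lemma jump_eq_0:
  assumes "sample \<theta> p q \<notin> closure S \<or> sample \<theta> p q \<in> interior S" "p \<noteq> q"
  shows "jump \<theta> S (p, q) = 0"
proof -
  have u: "q - p \<noteq> 0" using assms by simp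
  define x where "x = sample \<theta> p q"
  show ?thesis
    using assms(1)
  proof
    assume "sample \<theta> p q \<notin> closure S"
    then have "x \<notin> closure S" by (simp add: x_def)
    then have "right_germ (- closure S) x (q - p)" "x \<notin> S"
      using closure_subset by (auto intro!: right_germ_open simp: open_Compl)
    moreover have "\<not> right_germ S x (q - p)"
    proof
      assume "right_germ S x (q - p)"
      then have "right_germ (S \<inter> - closure S) x (q - p)"
        using calculation by (simp add: right_germ_Int)
      moreover have "S \<inter> - closure S = {}" using closure_subset by auto
      ultimately show False using not_right_germ_empty[OF u] by metis
    qed
    ultimately show ?thesis by (simp add: jump_def x_def)
  next
    assume "sample \<theta> p q \<in> interior S"
    then have "x \<in> interior S" by (simp add: x_def)
    then have "right_germ S x (q - p)" "x \<in> S"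
      using interior_subset right_germ_mono[OF right_germ_open[of "interior S"]] by blast+
    then show ?thesis by (simp add: jump_def x_def)
  qed
qed

section \<open>Rational simplices\<close>

lemma cross_rational:
  "a \<in> rational_points \<Longrightarrow> b \<in> rational_points \<Longrightarrow> cross a b \<in> \<rat>"
  by (simp add: cross_def rational_points_def)

lemma rational_points_diff:
  "a \<in> rational_points \<Longrightarrow> b \<in> rational_points \<Longrightarrow> a - b \<in> rational_points"
  by (simp add: rational_points_def)

lemma decided_open_segment:
  assumes ab: "a \<in> rational_points" "b \<in> rational_points" "a \<noteq> b"
    and pq: "p \<in> rational_points" "q \<in> rational_points" "p \<noteq> q" and \<theta>: "\<theta> \<notin> \<rat>"
  shows "decided (open_segment a b) (sample \<theta> p q) (q - p)"
proof -
  define u where "u = b - a"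
  have u: "Re u \<in> \<rat>" "Im u \<in> \<rat>" "Re a \<in> \<rat>" "Im a \<in> \<rat>" "Re b \<in> \<rat>" "Im b \<in> \<rat>"
    using ab by (auto simp: rational_points_def u_def)
  define H where "H \<alpha> \<beta> \<gamma> = {z. \<alpha> * Re z + \<beta> * Im z + \<gamma> > 0}" for \<alpha> \<beta> \<gamma>
  \<comment> \<open>The complements of \<open>A\<close> and \<open>B\<close> meet in the line
    through \<open>a\<close> and \<open>b\<close>; \<open>C\<close> and \<open>D\<close> are bounded
    by the perpendiculars to it at \<open>a\<close> and at \<open>b\<close>.\<close>
  define A where "A = H (- Im u) (Re u) (- cross u a)"
  define B where "B = H (Im u) (- Re u) (cross u a)"
  define C where "C = H (Re u) (Im u) (- (Re u * Re a + Im u * Im a))"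
  define D where "D = H (- Re u) (- Im u) (Re u * Re b + Im u * Im b)"
  have dH: "decided (H \<alpha> \<beta> \<gamma>) (sample \<theta> p q) (q - p)" if "\<alpha> \<in> \<rat>" "\<beta> \<in> \<rat>" "\<gamma> \<in> \<rat>" for \<alpha> \<beta> \<gamma>
    unfolding H_def using that by (rule decided_halfplane[OF _ _ _ pq \<theta>])
  have "cross u a \<in> \<rat>" using u by (simp add: cross_def)
  then have "decided A (sample \<theta> p q) (q - p)" "decided B (sample \<theta> p q) (q - p)"
    "decided C (sample \<theta> p q) (q - p)" "decided D (sample \<theta> p q) (q - p)"
    unfolding A_def B_def C_def D_def using u by (auto intro!: dH)
  then have "decided (- A \<inter> - B \<inter> C \<inter> D) (sample \<theta> p q) (q - p)"
    by (intro decided_Int decided_Compl)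
  also have "- A \<inter> - B \<inter> C \<inter> D = open_segment a b"
  proof (intro set_eqI iffI)
    fix z assume "z \<in> - A \<inter> - B \<inter> C \<inter> D"
    then have z: "cross u (z - a) = 0" "Re u * (Re z - Re a) + Im u * (Im z - Im a) > 0"
      "Re u * (Re b - Re z) + Im u * (Im b - Im z) > 0"
      by (auto simp: A_def B_def C_def D_def H_def cross_def algebra_simps)
    obtain s where s: "z - a = s *\<^sub>R u"
      using cross_eq_0D[OF z(1)] ab by (auto simp: u_def)
    define N where "N = (Re u)\<^sup>2 + (Im u)\<^sup>2"
    have "b - z = (1 - s) *\<^sub>R u" using s by (simp add: u_def algebra_simps)
    then have "Re b - Re z = (1 - s) * Re u" "Im b - Im z = (1 - s) * Im u"
      "Re z - Re a = s * Re u" "Im z - Im a = s * Im u"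
      using s by (simp_all add: complex_eq_iff)
    then have "s * N > 0" "(1 - s) * N > 0"
      using z by (simp_all add: N_def power2_eq_square algebra_simps)
    moreover have "N \<ge> 0" by (simp add: N_def)
    ultimately have "0 < s" "s < 1" by (auto simp: zero_less_mult_iff)
    moreover have "z = (1 - s) *\<^sub>R a + s *\<^sub>R b" using s by (simp add: u_def algebra_simps)
    ultimately show "z \<in> open_segment a b" using ab by (auto simp: in_segment)
  next
    fix z assume "z \<in> open_segment a b"
    then obtain s where s: "0 < s" "s < 1" "z = (1 - s) *\<^sub>R a + s *\<^sub>R b" by (auto simp: in_segment)
    define N where "N = (Re u)\<^sup>2 + (Im u)\<^sup>2"
    have "u \<noteq> 0" using ab by (simp add: u_def)
    then have "N > 0" by (auto simp: N_def sum_power2_gt_zero_iff complex_eq_iff)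
    have "z - a = s *\<^sub>R u" "b - z = (1 - s) *\<^sub>R u" using s by (simp_all add: u_def algebra_simps)
    then have e: "Re b - Re z = (1 - s) * Re u" "Im b - Im z = (1 - s) * Im u"
      "Re z - Re a = s * Re u" "Im z - Im a = s * Im u"
      by (simp_all add: complex_eq_iff)
    have "cross u (z - a) = 0" using \<open>z - a = s *\<^sub>R u\<close> by simp
    moreover have "Re u * (Re z - Re a) + Im u * (Im z - Im a) = s * N"
      unfolding e by (simp add: N_def power2_eq_square algebra_simps)
    moreover have "Re u * (Re b - Re z) + Im u * (Im b - Im z) = (1 - s) * N"
      unfolding e by (simp add: N_def power2_eq_square algebra_simps)
    moreover have "s * N > 0" "(1 - s) * N > 0" using s \<open>N > 0\<close> by auto
    ultimately show "z \<in> - A \<inter> - B \<inter> C \<inter> D"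
      by (auto simp: A_def B_def C_def D_def H_def cross_def algebra_simps)
  qed
  finally show ?thesis .
qed

text \<open>A rational point lies on a vertical and on a horizontal rational line. If it were the
  sample, both lines would contain \<open>p\<close> and \<open>q\<close>, which would then
  coincide.\<close>

lemma decided_singleton:
  assumes a: "a \<in> rational_points"
    and pq: "p \<in> rational_points" "q \<in> rational_points" "p \<noteq> q" and \<theta>: "\<theta> \<notin> \<rat>"
  shows "decided {a} (sample \<theta> p q) (q - p)" "sample \<theta> p q \<noteq> a"
proof -
  show "sample \<theta> p q \<noteq> a"
  proof
    assume *: "sample \<theta> p q = a"
    have "Re a \<in> \<rat>" "Im a \<in> \<rat>" using a by (auto simp: rational_points_def)
    then have "Re p = Re a" "Im p = Im a" "Re q = Re a" "Im q = Im a"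
      using rational_affine_sample_eq_0[of 1 0 "- Re a", OF _ _ _ pq(1,2) \<theta>]
        rational_affine_sample_eq_0[of 0 1 "- Im a", OF _ _ _ pq(1,2) \<theta>] * by auto
    then show False using pq by (auto simp: complex_eq_iff)
  qed
  then show "decided {a} (sample \<theta> p q) (q - p)"
    by (auto simp: decided_def intro!: right_germ_open)
qed

text \<open>Cramer's rule: barycentric coordinates are quotients of signed areas.\<close>

lemma triangle_coordinates:
  fixes a b c z :: complex
  defines "D \<equiv> cross (b - a) (c - a)"
  assumes D: "D \<noteq> 0"
  shows "(\<exists>\<alpha> \<beta> \<gamma>. S \<alpha> \<and> S \<beta> \<and> S \<gamma> \<and> \<alpha> + \<beta> + \<gamma> = 1 \<and> z = \<alpha> *\<^sub>R a + \<beta> *\<^sub>R b + \<gamma> *\<^sub>R c) \<longleftrightarrow>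
    S (cross (b - z) (c - z) / D) \<and> S (cross (c - z) (a - z) / D) \<and> S (cross (a - z) (b - z) / D)"
    (is "?L \<longleftrightarrow> ?R")
proof
  assume ?L
  then obtain \<alpha> \<beta> \<gamma> where S: "S \<alpha>" "S \<beta>" "S \<gamma>" and "\<alpha> + \<beta> + \<gamma> = 1"
    and z: "z = \<alpha> *\<^sub>R a + \<beta> *\<^sub>R b + \<gamma> *\<^sub>R c" by blast
  then have \<alpha>: "\<alpha> = 1 - \<beta> - \<gamma>" by simp
  have "cross (b - z) (c - z) = \<alpha> * D" "cross (c - z) (a - z) = \<beta> * D" "cross (a - z) (b - z) = \<gamma> * D"
    unfolding z \<alpha> D_def cross_def by (simp_all add: algebra_simps)
  then show ?R using S D by simp
next
  assume R: ?R
  show ?L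
  proof (intro exI conjI)
    have s: "cross (b - z) (c - z) + cross (c - z) (a - z) + cross (a - z) (b - z) = D"
      by (simp add: D_def cross_def algebra_simps)
    then show "cross (b - z) (c - z) / D + cross (c - z) (a - z) / D + cross (a - z) (b - z) / D = 1"
      using D by (simp flip: add_divide_distrib)
    have "D *\<^sub>R z = cross (b - z) (c - z) *\<^sub>R a + cross (c - z) (a - z) *\<^sub>R b + cross (a - z) (b - z) *\<^sub>R c"
      by (simp add: D_def cross_def complex_eq_iff algebra_simps)
    then have "(1 / D) *\<^sub>R (D *\<^sub>R z) = (1 / D) *\<^sub>R (cross (b - z) (c - z) *\<^sub>R a + cross (c - z) (a - z) *\<^sub>R b + cross (a - z) (b - z) *\<^sub>R c)"
      by simp
    then show "z = (cross (b - z) (c - z) / D) *\<^sub>R a + (cross (c - z) (a - z) / D) *\<^sub>R b + (cross (a - z) (b - z) / D) *\<^sub>R c"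
      using D by (simp add: scaleR_add_right)
  qed (use R in auto)
qed

text \<open>The quadratic terms in \<open>z\<close> cancel, so the condition is an affine inequality
  with rational coefficients.\<close>

lemma decided_cross:
  assumes ab: "a \<in> rational_points" "b \<in> rational_points" "D \<in> \<rat>"
    and pq: "p \<in> rational_points" "q \<in> rational_points" "p \<noteq> q" and \<theta>: "\<theta> \<notin> \<rat>"
  shows "decided {z. cross (a - z) (b - z) / D > 0} (sample \<theta> p q) (q - p)"
proof -
  have "{z. cross (a - z) (b - z) / D > 0} =
      {z. ((Im a - Im b) / D) * Re z + ((Re b - Re a) / D) * Im z + cross a b / D > 0}"
    by (auto simp: cross_def field_simps diff_divide_distrib add_divide_distrib)
  moreover have "decided {z. ((Im a - Im b) / D) * Re z + ((Re b - Re a) / D) * Im z + cross a b / D > 0}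
      (sample \<theta> p q) (q - p)"
    by (rule decided_halfplane[OF _ _ _ pq \<theta>])
      (use ab cross_rational[of a b] in \<open>auto simp: rational_points_def\<close>)
  ultimately show ?thesis by simp
qed

text \<open>Dividing by \<open>D\<close> makes the inequalities independent of the orientation of
  \<open>a\<close>, \<open>b\<close>, \<open>c\<close>. A point of the hull outside \<open>T\<close>
  has a vanishing barycentric coordinate and hence lies on a side.\<close>

lemma open_triangle:
  assumes V: "\<not> affine_dependent {a, b, c}" "a \<noteq> b" "a \<noteq> c" "b \<noteq> c"
  defines "D \<equiv> cross (b - a) (c - a)" and "T \<equiv> rel_interior (convex hull {a, b, c})"
  shows "D \<noteq> 0"
    and "T = {z. cross (b - z) (c - z) / D > 0} \<inter> {z. cross (c - z) (a - z) / D > 0} \<inter>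
      {z. cross (a - z) (b - z) / D > 0}" (is "_ = ?H")
    and "z \<in> convex hull {a, b, c} \<Longrightarrow> z \<notin> T \<Longrightarrow>
      z \<in> closed_segment a b \<or> z \<in> closed_segment b c \<or> z \<in> closed_segment a c"
    and "open T"
proof -
  show D: "D \<noteq> 0"
  proof
    assume "D = 0"
    then obtain s where "c - a = s *\<^sub>R (b - a)" using cross_eq_0D V by (metis D_def right_minus_eq)
    then have "c = (1 - s) *\<^sub>R a + s *\<^sub>R b" by (simp add: algebra_simps)
    then have "collinear {a, c, b}"
      unfolding collinear_3_expand by (intro disjI2 exI[of _ "1 - s"]) simp
    then show False using V by (simp add: collinear_3_eq_affine_dependent insert_commute)
  qed
  have sum3: "sum f {a, b, c} = f a + f b + f c" for f :: "complex \<Rightarrow> 'b::comm_monoid_add"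
    using V by (simp add: add.assoc)
  show T: "T = ?H"
  proof -
    have "z \<in> T \<longleftrightarrow> (\<exists>\<alpha> \<beta> \<gamma>. 0 < \<alpha> \<and> 0 < \<beta> \<and> 0 < \<gamma> \<and> \<alpha> + \<beta> + \<gamma> = 1 \<and> z = \<alpha> *\<^sub>R a + \<beta> *\<^sub>R b + \<gamma> *\<^sub>R c)"
      (is "_ \<longleftrightarrow> ?E") for z
    proof
      assume "z \<in> T"
      then obtain u where "\<forall>x\<in>{a,b,c}. 0 < u x" "sum u {a,b,c} = 1" "(\<Sum>x\<in>{a,b,c}. u x *\<^sub>R x) = z"
        unfolding T_def rel_interior_convex_hull_explicit[OF V(1)] by blast
      then have "0 < u a" "0 < u b" "0 < u c" "u a + u b + u c = 1"
        "z = u a *\<^sub>R a + u b *\<^sub>R b + u c *\<^sub>R c"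
        unfolding sum3 by auto
      then show ?E by (intro exI[of _ "u a"] exI[of _ "u b"] exI[of _ "u c"] conjI)
    next
      assume ?E
      then obtain \<alpha> \<beta> \<gamma> where *: "0 < \<alpha>" "0 < \<beta>" "0 < \<gamma>" "\<alpha> + \<beta> + \<gamma> = 1" "z = \<alpha> *\<^sub>R a + \<beta> *\<^sub>R b + \<gamma> *\<^sub>R c"
        by blast
      define u where "u x = (if x = a then \<alpha> else if x = b then \<beta> else \<gamma>)" for x
      have "\<forall>x\<in>{a,b,c}. 0 < u x" "sum u {a,b,c} = 1" "(\<Sum>x\<in>{a,b,c}. u x *\<^sub>R x) = z"
        unfolding sum3 using * V by (auto simp: u_def)
      then show "z \<in> T"
        unfolding T_def rel_interior_convex_hull_explicit[OF V(1)] by (intro CollectI exI[of _ u] conjI)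
    qed
    then have "z \<in> T \<longleftrightarrow> z \<in> ?H" for z
      using triangle_coordinates[of b a c "\<lambda>t. t > 0" z, folded D_def, OF D]
      unfolding Int_iff mem_Collect_eq by (simp only: conj_assoc)
    then show ?thesis by (rule set_eqI)
  qed
  show "open T"
  proof -
    have "continuous_on UNIV (\<lambda>z. cross (v - z) (w - z) / D)" for v w
      unfolding cross_def using D by (intro continuous_intros) auto
    then have "open {z. cross (v - z) (w - z) / D > 0}" for v w
      by (rule open_Collect_less[OF continuous_on_const])
    then show ?thesis unfolding T by (intro open_Int)
  qed
  assume z: "z \<in> convex hull {a, b, c}" "z \<notin> T"
  show "z \<in> closed_segment a b \<or> z \<in> closed_segment b c \<or> z \<in> closed_segment a c"
  proof -
    obtain \<alpha> \<beta> \<gamma> where *: "0 \<le> \<alpha>" "0 \<le> \<beta>" "0 \<le> \<gamma>" "\<alpha> + \<beta> + \<gamma> = 1" "z = \<alpha> *\<^sub>R a + \<beta> *\<^sub>R b + \<gamma> *\<^sub>R c"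
      using z(1) unfolding convex_hull_3 by blast
    have "\<not> (0 < \<alpha> \<and> 0 < \<beta> \<and> 0 < \<gamma>)"
    proof
      assume "0 < \<alpha> \<and> 0 < \<beta> \<and> 0 < \<gamma>"
      then have "\<exists>\<alpha> \<beta> \<gamma>. 0 < \<alpha> \<and> 0 < \<beta> \<and> 0 < \<gamma> \<and> \<alpha> + \<beta> + \<gamma> = 1 \<and> z = \<alpha> *\<^sub>R a + \<beta> *\<^sub>R b + \<gamma> *\<^sub>R c"
        using * by (intro exI[of _ \<alpha>] exI[of _ \<beta>] exI[of _ \<gamma>]) simp
      then have "z \<in> T"
        unfolding triangle_coordinates[of b a c "\<lambda>t. t > 0" z, folded D_def, OF D] T Int_iff mem_Collect_eq
        by (simp only: simp_thms)
      then show False using z(2) by blast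
    qed
    then consider "\<alpha> = 0" | "\<beta> = 0" | "\<gamma> = 0" using * by linarith
    then show ?thesis
    proof cases
      case 1
      then have "\<beta> = 1 - \<gamma>" using * by simp
      then have "z \<in> closed_segment b c" using * 1 by (auto simp: in_segment)
      then show ?thesis by simp
    next
      case 2
      then have "\<alpha> = 1 - \<gamma>" using * by simp
      then have "z \<in> closed_segment a c" using * 2 by (auto simp: in_segment)
      then show ?thesis by simp
    next
      case 3
      then have "\<alpha> = 1 - \<beta>" using * by simp
      then have "z \<in> closed_segment a b" using * 3 by (auto simp: in_segment)
      then show ?thesis by simp
    qed
  qed
qed

text \<open>In the plane an affinely independent set has at most three points. A nonzero jump puts
  the sample into the closure but not into the interior: impossible for a point, and on a side for a
  triangle.\<close>

lemma rational_simplex_jump: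
  assumes V: "V \<noteq> {}" "V \<subseteq> rational_points" "\<not> affine_dependent V"
    and pq: "p \<in> rational_points" "q \<in> rational_points" "p \<noteq> q" and \<theta>: "\<theta> \<notin> \<rat>"
  defines "T \<equiv> rel_interior (convex hull V)"
  shows "decided T (sample \<theta> p q) (q - p)"
    and "jump \<theta> T (p, q) \<noteq> 0 \<Longrightarrow> \<exists>a\<in>V. \<exists>b\<in>V. a \<noteq> b \<and> sample \<theta> p q \<in> closed_segment a b"
proof -
  let ?x = "sample \<theta> p q"
  have fin: "finite V" using V aff_independent_finite by blast
  have "card V \<le> 3"
    using affine_dependent_biggerset[OF fin] V by fastforce
  moreover have "card V > 0" using V fin by auto
  ultimately consider "card V = 1" | "card V = 2" | "card V = 3" by linarith
  then have "decided T ?x (q - p) \<and> (jump \<theta> T (p, q) \<noteq> 0 \<longrightarrow> (\<exists>a\<in>V. \<exists>b\<in>V. a \<noteq> b \<and> ?x \<in> closed_segment a b))"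
  proof cases
    case 1
    then obtain a where Va: "V = {a}" using card_1_singletonE by blast
    then have "T = {a}" by (simp add: T_def)
    then show ?thesis
      using decided_singleton[of a p q \<theta>, OF _ pq \<theta>] jump_eq_0[of \<theta> p q "{a}"] pq V Va by auto
  next
    case 2
    then obtain a b where ab: "V = {a, b}" "a \<noteq> b" by (auto simp: card_2_iff)
    then have T: "T = open_segment a b"
      using rel_interior_closed_segment[of a b] by (simp add: T_def segment_convex_hull)
    have "decided T ?x (q - p)" unfolding T using decided_open_segment V ab pq \<theta> by auto
    moreover have "?x \<in> closed_segment a b" if "jump \<theta> T (p, q) \<noteq> 0"
    proof -
      have "?x \<in> closure T" using jump_eq_0[of \<theta> p q T] that pq by blast
      then show ?thesis using T ab by (simp add: closure_open_segment)
    qed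
    ultimately show ?thesis using ab by blast
  next
    case 3
    then obtain a b c where abc: "V = {a, b, c}" "a \<noteq> b" "a \<noteq> c" "b \<noteq> c"
      by (auto simp: card_3_iff)
    note ot = open_triangle[of a b c, OF V(3)[unfolded abc(1)] abc(2-4), folded abc(1) T_def]
    have r: "a \<in> rational_points" "b \<in> rational_points" "c \<in> rational_points" using V abc by auto
    then have "cross (b - a) (c - a) \<in> \<rat>" by (intro cross_rational rational_points_diff)
    then have "decided T ?x (q - p)"
      unfolding ot(2) using r by (intro decided_Int decided_cross pq \<theta>)
    moreover have "\<exists>a\<in>V. \<exists>b\<in>V. a \<noteq> b \<and> ?x \<in> closed_segment a b" if "jump \<theta> T (p, q) \<noteq> 0"
    proof -
      have "?x \<in> closure T" "?x \<notin> interior T" using jump_eq_0[of \<theta> p q T] that pq by blast+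
      then have "?x \<in> convex hull V" "?x \<notin> T"
        using fin ot(4) unfolding T_def
        by (auto simp: interior_open convex_closure_rel_interior finite_imp_compact_convex_hull compact_imp_closed closure_closed)
      then show ?thesis using ot(3) abc by blast
    qed
    ultimately show ?thesis by blast
  qed
  then show "decided T ?x (q - p)"
    "jump \<theta> T (p, q) \<noteq> 0 \<Longrightarrow> \<exists>a\<in>V. \<exists>b\<in>V. a \<noteq> b \<and> ?x \<in> closed_segment a b" by blast+
qed

section \<open>Lattice points and minimal segments\<close>

lemma lattice_rational: "d > 0 \<Longrightarrow> z \<in> lattice d \<Longrightarrow> z \<in> rational_points"
proof -
  have "x \<in> \<rat>" if d: "d > 0" and x: "real d * x \<in> \<int>" for x
  proof -
    obtain k where "real d * x = of_int k" using x by (rule Ints_cases)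
    then have "x = of_int k / of_nat d" using d by (simp add: field_simps)
    then show ?thesis by simp
  qed
  then show "d > 0 \<Longrightarrow> z \<in> lattice d \<Longrightarrow> z \<in> rational_points"
    by (simp add: lattice_def rational_points_def)
qed

lemma lattice_closed: "a \<in> lattice d \<Longrightarrow> b \<in> lattice d \<Longrightarrow> c \<in> lattice d \<Longrightarrow> a + (b - c) \<in> lattice d"
  by (simp add: lattice_def algebra_simps)

lemma finite_lattice_cball:
  assumes "d > 0"
  shows "finite (lattice d \<inter> cball a r)"
proof -
  define R where "R = \<lceil>real d * (norm a + \<bar>r\<bar>)\<rceil>"
  define F where "F z = (\<lfloor>real d * Re z\<rfloor>, \<lfloor>real d * Im z\<rfloor>)" for z
  have inj: "inj_on F (lattice d)"
  proof (rule inj_onI)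
    fix x y assume xy: "x \<in> lattice d" "y \<in> lattice d" "F x = F y"
    have fl: "of_int \<lfloor>real d * Re z\<rfloor> = real d * Re z" "of_int \<lfloor>real d * Im z\<rfloor> = real d * Im z"
      if "z \<in> lattice d" for z
      using that by (simp_all add: lattice_def)
    have "\<lfloor>real d * Re x\<rfloor> = \<lfloor>real d * Re y\<rfloor>" "\<lfloor>real d * Im x\<rfloor> = \<lfloor>real d * Im y\<rfloor>"
      using xy by (auto simp: F_def)
    then have "real d * Re x = real d * Re y" "real d * Im x = real d * Im y"
      using fl[OF xy(1)] fl[OF xy(2)] by metis+
    then show "x = y" using assms by (simp add: complex_eq_iff)
  qed
  have bound: "\<lfloor>real d * t\<rfloor> \<in> {-R..R}" if "\<bar>t\<bar> \<le> norm a + \<bar>r\<bar>" for t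
  proof -
    have "real d * \<bar>t\<bar> \<le> real d * (norm a + \<bar>r\<bar>)" using that by (simp add: mult_left_mono)
    then have *: "\<bar>real d * t\<bar> \<le> of_int R" unfolding R_def by (simp add: abs_mult) linarith
    then have "real d * t \<le> of_int R" "real_of_int (- R) \<le> real d * t" by auto
    then show ?thesis by (simp add: le_floor_iff floor_le_iff)
  qed
  have "F ` (lattice d \<inter> cball a r) \<subseteq> {-R..R} \<times> {-R..R}"
  proof (rule image_subsetI)
    fix z assume "z \<in> lattice d \<inter> cball a r"
    then have "norm z \<le> norm a + \<bar>r\<bar>"
      using norm_triangle_ineq2[of z a] by (auto simp: dist_norm norm_minus_commute)
    then have "\<bar>Re z\<bar> \<le> norm a + \<bar>r\<bar>" "\<bar>Im z\<bar> \<le> norm a + \<bar>r\<bar>"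
      using abs_Re_le_cmod[of z] abs_Im_le_cmod[of z] by linarith+
    then show "F z \<in> {-R..R} \<times> {-R..R}" using bound by (simp add: F_def)
  qed
  then have "finite (F ` (lattice d \<inter> cball a r))" using finite_subset by blast
  then show ?thesis using inj by (meson finite_imageD inf_le1 inj_on_subset)
qed

lemma minimal_segment_lattice:
  "minimal_segment d p q \<Longrightarrow> p \<in> lattice d" "minimal_segment d p q \<Longrightarrow> q \<in> lattice d"
  "minimal_segment d p q \<Longrightarrow> p \<noteq> q"
  unfolding minimal_segment_def by blast+

lemma minimal_segment_lattice_param:
  assumes "minimal_segment d p q" "p + t *\<^sub>R (q - p) \<in> lattice d" "0 \<le> t" "t \<le> 1"
  shows "t = 0 \<or> t = 1"
proof -
  have "p + t *\<^sub>R (q - p) \<in> closed_segment p q"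
    using assms unfolding in_segment by (intro exI[of _ t]) (simp add: algebra_simps)
  then have "p + t *\<^sub>R (q - p) = p \<or> p + t *\<^sub>R (q - p) = q"
    using assms(1,2) unfolding minimal_segment_def by blast
  moreover have "p + t *\<^sub>R (q - p) - q = (t - 1) *\<^sub>R (q - p)" by (simp add: algebra_simps)
  ultimately show ?thesis using minimal_segment_lattice(3)[OF assms(1)] by auto
qed

lemma minimal_segment_commute: "minimal_segment d p q \<longleftrightarrow> minimal_segment d q p"
  unfolding minimal_segment_def closed_segment_commute[of p q] by (auto simp: insert_commute)

text \<open>A minimal segment is primitive: a shorter parallel lattice vector, pointed the right way
  and added to \<open>p\<close>, would give a lattice point strictly inside it.\<close>

lemma parallel_lattice_vector_length:
  assumes "minimal_segment d p q" "a \<in> lattice d" "b \<in> lattice d" "b - a = k *\<^sub>R (q - p)" "k \<noteq> 0"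
  shows "\<bar>k\<bar> \<ge> 1"
proof (rule ccontr)
  assume k: "\<not> ?thesis"
  have "p + \<bar>k\<bar> *\<^sub>R (q - p) \<in> lattice d"
  proof (cases "k > 0")
    case True
    then show ?thesis
      using lattice_closed[OF minimal_segment_lattice(1)[OF assms(1)] assms(3,2)] assms(4) by simp
  next
    case False
    then have "\<bar>k\<bar> *\<^sub>R (q - p) = - (b - a)" using assms(4) by simp
    also have "\<dots> = a - b" by simp
    finally show ?thesis
      using lattice_closed[OF minimal_segment_lattice(1)[OF assms(1)] assms(2,3)] by simp
  qed
  then show False
    using minimal_segment_lattice_param[OF assms(1), of "\<bar>k\<bar>"] k assms(5) by auto
qed

text \<open>The line through \<open>a\<close> and \<open>b\<close> has a rational equation, so with
  the sample it also contains \<open>p\<close> and \<open>q\<close>.\<close>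

lemma sample_on_rational_line:
  assumes "a \<in> rational_points" "b \<in> rational_points" "a \<noteq> b"
    and pq: "p \<in> rational_points" "q \<in> rational_points" "p \<noteq> q" and \<theta>: "\<theta> \<notin> \<rat>"
    and x: "sample \<theta> p q \<in> closed_segment a b"
  obtains k where "k \<noteq> 0" "b - a = k *\<^sub>R (q - p)"
proof -
  define u where "u = b - a"
  have u: "Re u \<in> \<rat>" "Im u \<in> \<rat>" "Re a \<in> \<rat>" "Im a \<in> \<rat>" "cross u a \<in> \<rat>" "u \<noteq> 0"
    using assms by (auto simp: rational_points_def u_def cross_def)
  obtain s where "sample \<theta> p q = (1 - s) *\<^sub>R a + s *\<^sub>R b" using x by (auto simp: in_segment)
  then have "sample \<theta> p q = a + s *\<^sub>R u" by (simp add: u_def algebra_simps)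
  then have "cross u (sample \<theta> p q) - cross u a = 0" by simp
  then have "- Im u * Re (sample \<theta> p q) + Re u * Im (sample \<theta> p q) + - cross u a = 0"
    by (simp add: cross_def)
  then have "- Im u * Re p + Re u * Im p + - cross u a = 0" "- Im u * Re q + Re u * Im q + - cross u a = 0"
    using u by (intro rational_affine_sample_eq_0[OF _ _ _ pq(1,2) \<theta>]; auto)+
  then have "cross (q - p) u = 0" by (simp add: cross_def algebra_simps)
  then obtain k where "u = k *\<^sub>R (q - p)" using cross_eq_0D pq by (metis right_minus_eq)
  then show thesis using that[of k] u by (auto simp: u_def)
qed

text \<open>All these segments are parallel to \<open>b - a\<close>. By primitivity none is longer
  than one fixed member of the set, so their ends are lattice points in a common disc.\<close>

lemma finite_minimal_segments_sample:
  assumes d: "d > 0" and ab: "a \<in> rational_points" "b \<in> rational_points" "a \<noteq> b" and \<theta>: "\<theta> \<notin> \<rat>"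
  shows "finite {(p, q). minimal_segment d p q \<and> sample \<theta> p q \<in> closed_segment a b}" (is "finite ?S")
proof (cases "?S = {}")
  case True
  then show ?thesis by (simp only: finite.emptyI)
next
  case False
  then obtain p0 q0 where 0: "minimal_segment d p0 q0" "sample \<theta> p0 q0 \<in> closed_segment a b" by auto
  \<comment> \<open>The distance from \<open>a\<close> to an end: at most
    \<open>norm (b - a)\<close> to the sample, \<open>\<bar>\<theta>\<bar>\<close> lengths from
    there to \<open>p\<close>, and one more length to \<open>q\<close>.\<close>
  define B where "B = (1 + \<bar>\<theta>\<bar>) * norm (q0 - p0) + norm (b - a)"
  have dir: "\<exists>k. k \<noteq> 0 \<and> b - a = k *\<^sub>R (q - p)"
    if "minimal_segment d p q" "sample \<theta> p q \<in> closed_segment a b" for p q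
    using sample_on_rational_line[OF ab _ _ _ \<theta> that(2)] minimal_segment_lattice[OF that(1)] lattice_rational[OF d]
    by metis
  have "?S \<subseteq> (lattice d \<inter> cball a B) \<times> (lattice d \<inter> cball a B)"
  proof safe
    fix p q assume s: "minimal_segment d p q" "sample \<theta> p q \<in> closed_segment a b"
    show L: "p \<in> lattice d" "q \<in> lattice d" using minimal_segment_lattice[OF s(1)] by auto
    obtain k0 k where k: "k0 \<noteq> 0" "b - a = k0 *\<^sub>R (q0 - p0)" "k \<noteq> 0" "b - a = k *\<^sub>R (q - p)"
      using dir[OF s] dir[OF 0] by blast
    have "(k / k0) *\<^sub>R (q - p) = (1 / k0) *\<^sub>R (b - a)" using k(4) by simp
    also have "\<dots> = q0 - p0" unfolding k(2) using k(1) by simp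
    finally have "q0 - p0 = (k / k0) *\<^sub>R (q - p)" ..
    then have "1 \<le> \<bar>k / k0\<bar>"
      using parallel_lattice_vector_length[OF s(1) minimal_segment_lattice(1,2)[OF 0(1)], of "k / k0"] k
      by simp
    have n0: "norm (q0 - p0) = \<bar>k / k0\<bar> * norm (q - p)"
      unfolding \<open>q0 - p0 = (k / k0) *\<^sub>R (q - p)\<close> by simp
    with \<open>1 \<le> \<bar>k / k0\<bar>\<close> have "1 * norm (q - p) \<le> norm (q0 - p0)"
      unfolding n0 by (intro mult_right_mono) auto
    then have le: "norm (q - p) \<le> norm (q0 - p0)" by simp
    have "dist (sample \<theta> p q) a \<le> norm (b - a)"
      using segment_bound1[OF s(2)] by (simp add: dist_norm)
    moreover have "dist (sample \<theta> p q) p \<le> \<bar>\<theta>\<bar> * norm (q0 - p0)"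
      using le by (simp add: sample_def dist_norm mult_left_mono)
    moreover have "dist p q \<le> norm (q0 - p0)" using le by (simp add: dist_norm norm_minus_commute)
    moreover have "dist a p \<le> dist (sample \<theta> p q) a + dist (sample \<theta> p q) p"
      by (metis dist_commute dist_triangle)
    moreover have "dist a q \<le> dist a p + dist p q" by (rule dist_triangle)
    moreover have "B = norm (q0 - p0) + \<bar>\<theta>\<bar> * norm (q0 - p0) + norm (b - a)"
      by (simp add: B_def algebra_simps)
    ultimately show "p \<in> cball a B" "q \<in> cball a B" using norm_ge_zero[of "q0 - p0"]
      unfolding mem_cball by linarith+
  qed
  then show ?thesis
    using finite_lattice_cball[OF d] by (meson finite_SigmaI finite_subset)
qed

lemma finite_jump_rational_simplex:
  assumes "d > 0" "rational_open_simplex T" "\<theta> \<notin> \<rat>"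
  shows "finite {(p, q). minimal_segment d p q \<and> jump \<theta> T (p, q) \<noteq> 0}"
proof -
  obtain V where V: "V \<noteq> {}" "V \<subseteq> rational_points" "\<not> affine_dependent V" "T = rel_interior (convex hull V)"
    using assms(2) by (auto simp: rational_open_simplex_def)
  define I where "I = {(a, b). a \<in> V \<and> b \<in> V \<and> a \<noteq> b}"
  have "finite V" using V aff_independent_finite by blast
  moreover have "I \<subseteq> V \<times> V" by (auto simp: I_def)
  ultimately have "finite I" by (meson finite_SigmaI finite_subset)
  have sub: "{(p, q). minimal_segment d p q \<and> jump \<theta> T (p, q) \<noteq> 0} \<subseteq>
      (\<Union>(a, b)\<in>I. {(p, q). minimal_segment d p q \<and> sample \<theta> p q \<in> closed_segment a b})"
  proof clarify
    fix p q assume s: "minimal_segment d p q" "jump \<theta> T (p, q) \<noteq> 0"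
    have "p \<in> rational_points" "q \<in> rational_points" "p \<noteq> q"
      using minimal_segment_lattice[OF s(1)] lattice_rational[OF assms(1)] by auto
    then have "\<exists>a\<in>V. \<exists>b\<in>V. a \<noteq> b \<and> sample \<theta> p q \<in> closed_segment a b"
      using rational_simplex_jump(2)[OF V(1-3) _ _ _ assms(3) s(2)[unfolded V(4)]] by simp
    then show "(p, q) \<in> (\<Union>(a, b)\<in>I. {(p, q). minimal_segment d p q \<and> sample \<theta> p q \<in> closed_segment a b})"
      using s(1) by (auto simp: I_def)
  qed
  have "finite {(p, q). minimal_segment d p q \<and> sample \<theta> p q \<in> closed_segment a b}" if "(a, b) \<in> I" for a b
    by (rule finite_minimal_segments_sample[OF assms(1) _ _ _ assms(3)])
      (use that V in \<open>auto simp: I_def\<close>)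
  then have "finite (\<Union>(a, b)\<in>I. {(p, q). minimal_segment d p q \<and> sample \<theta> p q \<in> closed_segment a b})"
    using \<open>finite I\<close> by (intro finite_UN_I) (simp_all only: split_paired_all prod.case)
  then show ?thesis using sub by (rule rev_finite_subset)
qed

section \<open>Invariance under \<open>G\<close>\<close>

lemma G_mapsE:
  assumes "g \<in> G_maps"
  obtains a b c e m n :: int where "a * e - b * c = 1 \<or> a * e - b * c = -1"
    "\<And>z. g z = Complex (of_int a * Re z + of_int b * Im z + of_int m)
      (of_int c * Re z + of_int e * Im z + of_int n)"
proof -
  obtain U v where g: "g = affine_action U v" and "invertible U"
    using assms by (auto simp: G_maps_def)
  then obtain U' where "U ** U' = mat 1" by (auto simp: invertible_def)
  then have "det U * det U' = 1" by (metis det_I det_mul)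
  then have "det U = 1 \<or> det U = -1" by (auto simp: zmult_eq_1_iff)
  then show thesis
    using that[of "U $ 1 $ 1" "U $ 2 $ 2" "U $ 1 $ 2" "U $ 2 $ 1" "v $ 1" "v $ 2"]
    by (simp add: det_2 g affine_action_def)
qed

lemma weight_cong:
  assumes "of_int w = real d * Re p" "of_int x = real d * Im p"
    "of_int y = real d * Re q" "of_int z = real d * Im q"
  shows "weight d p q = (w * z - x * y) mod int d"
  unfolding weight_def Let_def by (simp flip: assms)

text \<open>Exchanging the ends negates a weight, and so does a linear part of determinant -1. Hence
  the weight is kept if orientation reversing maps also exchange the ends.\<close>

lemma G_maps_properties:
  assumes "g \<in> G_maps"
  obtains L :: "complex \<Rightarrow> complex" and \<delta> :: real where "\<delta> = 1 \<or> \<delta> = -1" "linear L"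
    "\<And>z w. g (z + w) = g z + L w" "\<And>u w. cross (L u) (L w) = \<delta> * cross u w"
    "bij g" "\<And>d z. g z \<in> lattice d \<longleftrightarrow> z \<in> lattice d"
    "\<And>d p q. \<delta> = 1 \<Longrightarrow> p \<in> lattice d \<Longrightarrow> q \<in> lattice d \<Longrightarrow> weight d (g p) (g q) = weight d p q"
    "\<And>d p q. \<delta> = -1 \<Longrightarrow> p \<in> lattice d \<Longrightarrow> q \<in> lattice d \<Longrightarrow> weight d (g q) (g p) = weight d p q"
proof -
  obtain a b c e m n :: int where D: "a * e - b * c = 1 \<or> a * e - b * c = -1" and
    g: "\<And>z. g z = Complex (of_int a * Re z + of_int b * Im z + of_int m)
      (of_int c * Re z + of_int e * Im z + of_int n)"
    by (rule G_mapsE[OF assms]) blast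
  define \<Delta> where "\<Delta> = a * e - b * c"
  define \<delta> where "\<delta> = real_of_int \<Delta>"
  define L where "L w = Complex (of_int a * Re w + of_int b * Im w) (of_int c * Re w + of_int e * Im w)" for w
  \<comment> \<open>The inverse of \<open>g\<close>: the adjugate matrix times
    \<open>\<delta>\<close>, which is its own reciprocal.\<close>
  define h where "h z = Complex (\<delta> * (of_int e * (Re z - of_int m) - of_int b * (Im z - of_int n)))
      (\<delta> * (of_int a * (Im z - of_int n) - of_int c * (Re z - of_int m)))" for z
  have \<Delta>: "\<Delta> = 1 \<or> \<Delta> = -1" using D by (simp add: \<Delta>_def)
  then have \<delta>: "\<delta> = 1 \<or> \<delta> = -1" by (auto simp: \<delta>_def)
  have \<delta>_eq: "\<delta> = of_int a * of_int e - of_int b * of_int c" by (simp add: \<delta>_def \<Delta>_def)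
  have \<delta>\<delta>: "\<delta> * \<delta> = 1" using \<delta> by auto
  have hg: "h (g z) = z" for z
  proof -
    have "Re (h (g z)) = \<delta> * \<delta> * Re z" "Im (h (g z)) = \<delta> * \<delta> * Im z"
      unfolding h_def g complex.sel \<delta>_eq by (simp_all add: algebra_simps)
    then show ?thesis by (simp add: complex_eq_iff \<delta>\<delta>)
  qed
  have gh: "g (h z) = z" for z
  proof -
    have "Re (g (h z)) = \<delta> * \<delta> * (Re z - of_int m) + of_int m" "Im (g (h z)) = \<delta> * \<delta> * (Im z - of_int n) + of_int n"
      unfolding h_def g complex.sel \<delta>_eq by (simp_all add: algebra_simps)
    then show ?thesis by (simp add: complex_eq_iff \<delta>\<delta>)
  qed
  have bij: "bij g" by (rule bij_betw_byWitness[where f' = h]) (auto simp: gh hg)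
  have gl: "real d * Re (g z) = of_int a * (real d * Re z) + of_int b * (real d * Im z) + of_int (int d * m)"
    "real d * Im (g z) = of_int c * (real d * Re z) + of_int e * (real d * Im z) + of_int (int d * n)" for d z
    by (simp_all add: g algebra_simps)
  have hl: "real d * Re (h z) = of_int \<Delta> * (of_int e * (real d * Re z - of_int (int d * m)) - of_int b * (real d * Im z - of_int (int d * n)))"
    "real d * Im (h z) = of_int \<Delta> * (of_int a * (real d * Im z - of_int (int d * n)) - of_int c * (real d * Re z - of_int (int d * m)))" for d z
    by (simp_all add: h_def \<delta>_def algebra_simps)
  have int: "of_int i * X + of_int j * Y + of_int k \<in> \<int>"
    "of_int l * (of_int i * (X - of_int k) - of_int j * (Y - of_int k')) \<in> \<int>"
    if "X \<in> \<int>" "Y \<in> \<int>" for i j k k' l and X Y :: real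
    using that by auto
  have lat: "g z \<in> lattice d \<longleftrightarrow> z \<in> lattice d" for d z
  proof
    assume "z \<in> lattice d"
    then show "g z \<in> lattice d"
      unfolding lattice_def mem_Collect_eq gl by (elim conjE) (intro conjI int)
  next
    assume "g z \<in> lattice d"
    then have "h (g z) \<in> lattice d"
      unfolding lattice_def mem_Collect_eq hl by (elim conjE) (intro conjI int)
    then show "z \<in> lattice d" by (simp add: hg)
  qed
  have wt: "\<exists>k. weight d p q = k mod int d \<and> weight d (g p) (g q) = (\<Delta> * k) mod int d \<and>
      weight d (g q) (g p) = (- \<Delta> * k) mod int d"
    if p: "p \<in> lattice d" and q: "q \<in> lattice d" for d p q
  proof -
    obtain w x y z where wx: "of_int w = real d * Re p" "of_int x = real d * Im p"
      and yz: "of_int y = real d * Re q" "of_int z = real d * Im q"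
      using p q unfolding lattice_def by (auto elim!: Ints_cases)
    have gp: "of_int (a * w + b * x + int d * m) = real d * Re (g p)"
      "of_int (c * w + e * x + int d * n) = real d * Im (g p)"
      and gq: "of_int (a * y + b * z + int d * m) = real d * Re (g q)"
      "of_int (c * y + e * z + int d * n) = real d * Im (g q)"
      unfolding gl by (simp_all add: wx yz)
    \<comment> \<open>On numerators an integer translation acts by multiples of \<open>d\<close>, so
      it changes the determinant by a multiple of \<open>d\<close>; the linear part contributes the
      factor \<open>\<Delta>\<close>.\<close>
    have eq: "(a * w + b * x + int d * m) * (c * y + e * z + int d * n) -
        (c * w + e * x + int d * n) * (a * y + b * z + int d * m) - \<Delta> * (w * z - x * y) =
        int d * (n * (a * w + b * x) + m * (c * y + e * z) - m * (c * w + e * x) - n * (a * y + b * z))"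
      by (simp add: \<Delta>_def algebra_simps)
    have "weight d (g p) (g q) = (\<Delta> * (w * z - x * y)) mod int d"
      unfolding weight_cong[OF gp gq] mod_eq_dvd_iff eq by simp
    moreover have "weight d (g q) (g p) = (- \<Delta> * (w * z - x * y)) mod int d"
    proof -
      have "(a * y + b * z + int d * m) * (c * w + e * x + int d * n) -
        (c * y + e * z + int d * n) * (a * w + b * x + int d * m) - - \<Delta> * (w * z - x * y) =
        - (int d * (n * (a * w + b * x) + m * (c * y + e * z) - m * (c * w + e * x) - n * (a * y + b * z)))"
        unfolding eq[symmetric] by (simp add: algebra_simps)
      then show ?thesis unfolding weight_cong[OF gq gp] mod_eq_dvd_iff by simp
    qed
    ultimately show ?thesis using weight_cong[OF wx yz] by blast
  qed
  show thesis
  proof (rule that[OF \<delta> _ _ _ bij lat])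
    show "linear L" by (rule linearI) (simp_all add: L_def complex_eq_iff algebra_simps)
    show "g (z + w) = g z + L w" for z w by (simp add: g L_def complex_eq_iff algebra_simps)
    show "cross (L u) (L w) = \<delta> * cross u w" for u w
      unfolding \<delta>_eq by (simp add: L_def cross_def algebra_simps)
    show "weight d (g p) (g q) = weight d p q" if "\<delta> = 1" "p \<in> lattice d" "q \<in> lattice d" for d p q
      using wt[OF that(2,3)] that(1) by (auto simp: \<delta>_def)
    show "weight d (g q) (g p) = weight d p q" if "\<delta> = -1" "p \<in> lattice d" "q \<in> lattice d" for d p q
    proof -
      have "\<Delta> = -1" using \<Delta> that(1) by (auto simp: \<delta>_def)
      then show ?thesis using wt[OF that(2,3)] by auto
    qed
  qed
qed

text \<open>An orientation reversing map sends the right side of \<open>(p, q)\<close> to the right side of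
  \<open>(g q, g p)\<close>. Reversing a segment exchanges the parameters \<open>\<theta>\<close> and \<open>1 - \<theta>\<close>, so both are used.\<close>

definition total_jump :: "real \<Rightarrow> complex set \<Rightarrow> complex \<times> complex \<Rightarrow> int"
  where "total_jump \<theta> S s = jump \<theta> S s + jump (1 - \<theta>) S s"

definition weight_segments :: "nat \<Rightarrow> int \<Rightarrow> (complex \<times> complex) set"
  where "weight_segments d k = {(p, q). minimal_segment d p q \<and> weight d p q = k}"

text \<open>The factor \<open>\<delta>\<close> by which \<open>L\<close> changes
  \<open>cross\<close> is cancelled by the one in front of \<open>L u\<close>, so directions on the
  right stay on the right.\<close>

lemma right_germ_affine_image:
  assumes g: "\<And>z w. g (z + w) = g z + L w" "bij g" and L: "linear L"
    and c: "\<And>u w. cross (L u) (L w) = \<delta> * cross u w" and \<delta>: "\<delta> = 1 \<or> \<delta> = -1"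
  shows "right_germ (g ` S) (g x) (\<delta> *\<^sub>R L u) \<longleftrightarrow> right_germ S x u"
proof -
  have mem: "g x + e *\<^sub>R L w \<in> g ` S \<longleftrightarrow> x + e *\<^sub>R w \<in> S" for e w
    using g linear_scale[OF L, of e w] by (metis bij_is_inj inj_image_mem_iff)
  have cr: "cross (\<delta> *\<^sub>R L u) (L w) = cross u w" for w
    using c \<delta> by auto
  have surj: "\<exists>w. v = L w" for v
  proof -
    obtain y where "g x + v = g y" using g(2) by (metis bij_pointE)
    then have "v = L (y - x)" using g(1)[of x "y - x"] by simp
    then show ?thesis by blast
  qed
  show ?thesis
  proof
    assume R: "right_germ (g ` S) (g x) (\<delta> *\<^sub>R L u)"
    show "right_germ S x u"
      unfolding right_germ_def
    proof (intro allI impI)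
      fix w assume "cross u w < 0"
      then have "cross (\<delta> *\<^sub>R L u) (L w) < 0" unfolding cr .
      then have "\<forall>\<^sub>F e in at_right (0::real). g x + e *\<^sub>R L w \<in> g ` S"
        using R unfolding right_germ_def by blast
      then show "\<forall>\<^sub>F e in at_right (0::real). x + e *\<^sub>R w \<in> S" unfolding mem .
    qed
  next
    assume R: "right_germ S x u"
    show "right_germ (g ` S) (g x) (\<delta> *\<^sub>R L u)"
      unfolding right_germ_def
    proof (intro allI impI)
      fix v assume v: "cross (\<delta> *\<^sub>R L u) v < 0"
      obtain w where w: "v = L w" using surj by blast
      have "cross u w < 0" using v unfolding w cr .
      then have "\<forall>\<^sub>F e in at_right (0::real). x + e *\<^sub>R w \<in> S"
        using R unfolding right_germ_def by blast
      then show "\<forall>\<^sub>F e in at_right (0::real). g x + e *\<^sub>R v \<in> g ` S" unfolding w mem .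
    qed
  qed
qed

lemma G_maps_segment_bijection:
  assumes "g \<in> G_maps"
  obtains \<tau> where "bij_betw \<tau> (weight_segments d k) (weight_segments d k)"
    "\<And>\<theta> S s. total_jump \<theta> (g ` S) (\<tau> s) = total_jump \<theta> S s"
proof -
  obtain L :: "complex \<Rightarrow> complex" and \<delta> :: real where \<delta>: "\<delta> = 1 \<or> \<delta> = -1" and L: "linear L"
    and gL: "\<And>z w. g (z + w) = g z + L w" and c: "\<And>u w. cross (L u) (L w) = \<delta> * cross u w"
    and bij: "bij g" and lat: "\<And>d z. g z \<in> lattice d \<longleftrightarrow> z \<in> lattice d"
    and w1: "\<And>d p q. \<delta> = 1 \<Longrightarrow> p \<in> lattice d \<Longrightarrow> q \<in> lattice d \<Longrightarrow> weight d (g p) (g q) = weight d p q"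
    and w2: "\<And>d p q. \<delta> = -1 \<Longrightarrow> p \<in> lattice d \<Longrightarrow> q \<in> lattice d \<Longrightarrow> weight d (g q) (g p) = weight d p q"
    by (rule G_maps_properties[OF assms]) blast
  have inj: "inj g" and surj: "surj g" using bij by (auto simp: bij_def)
  have comb: "g (p + t *\<^sub>R (q - p)) = g p + t *\<^sub>R (g q - g p)" for p q t
    using gL[of p "t *\<^sub>R (q - p)"] gL[of p "q - p"] linear_scale[OF L, of t "q - p"] by simp
  have diff: "g q - g p = L (q - p)" for p q using gL[of p "q - p"] by simp
  have seg: "closed_segment (g p) (g q) = g ` closed_segment p q" for p q
  proof -
    have e: "(1 - t) *\<^sub>R a + t *\<^sub>R b = a + t *\<^sub>R (b - a)" for a b :: complex and t
      by (simp add: algebra_simps)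
    show ?thesis unfolding closed_segment_def e comb[symmetric] by blast
  qed
  have min: "minimal_segment d (g p) (g q) \<longleftrightarrow> minimal_segment d p q" for p q
  proof -
    have "g ` closed_segment p q \<inter> lattice d = g ` (closed_segment p q \<inter> lattice d)"
      using lat by auto
    then have "g ` closed_segment p q \<inter> lattice d = {g p, g q} \<longleftrightarrow> closed_segment p q \<inter> lattice d = {p, q}"
      using inj_image_eq_iff[OF inj, of "closed_segment p q \<inter> lattice d" "{p, q}"] by simp
    then show ?thesis unfolding minimal_segment_def seg using inj_eq[OF inj] by simp
  qed
  define \<tau> where "\<tau> = (\<lambda>(p, q). if \<delta> = 1 then (g p, g q) else (g q, g p))"
  have in_iff: "\<tau> s \<in> weight_segments d k \<longleftrightarrow> s \<in> weight_segments d k" for s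
  proof -
    obtain p q where s: "s = (p, q)" by (cases s)
    show ?thesis
    proof (cases "minimal_segment d p q")
      case True
      then have "p \<in> lattice d" "q \<in> lattice d" using minimal_segment_lattice by blast+
      then show ?thesis
        using True \<delta> w1 w2 min[of p q] min[of q p] minimal_segment_commute[of d p q]
        by (auto simp: \<tau>_def s weight_segments_def)
    next
      case False
      then show ?thesis
        using min[of p q] min[of q p] minimal_segment_commute[of d p q]
        by (auto simp: \<tau>_def s weight_segments_def)
    qed
  qed
  have "inj \<tau>" using inj_eq[OF inj] by (auto simp: \<tau>_def inj_def split: if_splits)
  have "surj \<tau>"
  proof (rule surjI[of _ "\<lambda>(p, q). if \<delta> = 1 then (inv g p, inv g q) else (inv g q, inv g p)"])
    show "\<tau> (case s of (p, q) \<Rightarrow> if \<delta> = 1 then (inv g p, inv g q) else (inv g q, inv g p)) = s" for s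
      using surj by (cases s) (auto simp: \<tau>_def surj_f_inv_f)
  qed
  have "\<tau> ` weight_segments d k = weight_segments d k"
  proof
    show "\<tau> ` weight_segments d k \<subseteq> weight_segments d k" using in_iff by blast
    show "weight_segments d k \<subseteq> \<tau> ` weight_segments d k"
    proof
      fix s assume "s \<in> weight_segments d k"
      moreover obtain t where "s = \<tau> t" using \<open>surj \<tau>\<close> by (metis surjD)
      ultimately show "s \<in> \<tau> ` weight_segments d k" using in_iff by blast
    qed
  qed
  then have "bij_betw \<tau> (weight_segments d k) (weight_segments d k)"
    using \<open>inj \<tau>\<close> by (auto simp: bij_betw_def intro: inj_on_subset)
  moreover have "total_jump \<theta> (g ` S) (\<tau> s) = total_jump \<theta> S s" for \<theta> S s
  proof -
    obtain p q where s: "s = (p, q)" by (cases s)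
    note rg = right_germ_affine_image[OF gL bij L c \<delta>]
    have mem: "g x \<in> g ` S \<longleftrightarrow> x \<in> S" for x using inj by (simp add: inj_image_mem_iff)
    have samp: "sample t (g p) (g q) = g (sample t p q)" "sample t (g q) (g p) = g (sample (1 - t) p q)" for t
    proof -
      show "sample t (g p) (g q) = g (sample t p q)" by (simp add: sample_def comb)
      have "sample (1 - t) p q = q + t *\<^sub>R (p - q)" by (simp add: sample_def algebra_simps)
      then show "sample t (g q) (g p) = g (sample (1 - t) p q)" by (simp add: sample_def comb)
    qed
    have 1: "jump t (g ` S) (g p, g q) = jump t S (p, q)" if "\<delta> = 1" for t
      using rg[of S _ "q - p"] that by (simp add: jump_def samp mem diff)
    have 2: "jump t (g ` S) (g q, g p) = jump (1 - t) S (p, q)" if "\<delta> = -1" for t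
    proof -
      have "g p - g q = - (g q - g p)" by simp
      also have "\<dots> = \<delta> *\<^sub>R L (q - p)" unfolding diff using that by simp
      finally have "g p - g q = \<delta> *\<^sub>R L (q - p)" .
      then show ?thesis using rg[of S _ "q - p"] by (simp add: jump_def samp mem)
    qed
    show ?thesis
      using \<delta> 1 2[of \<theta>] 2[of "1 - \<theta>"] by (auto simp: total_jump_def \<tau>_def s)
  qed
  ultimately show thesis by (rule that)
qed

section \<open>Boundary segments of a polygon\<close>

lemma sample_in_open_segment:
  assumes "0 < \<theta>" "\<theta> < 1" "p \<noteq> q"
  shows "sample \<theta> p q \<in> open_segment p q"
  using assms by (auto simp: in_segment sample_def algebra_simps intro!: exI[of _ \<theta>])

lemma right_germ_scaleR: "c > 0 \<Longrightarrow> right_germ S x (c *\<^sub>R u) \<longleftrightarrow> right_germ S x u"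
  by (simp add: right_germ_def mult_less_0_iff)

lemma not_right_germ_both: "u \<noteq> 0 \<Longrightarrow> right_germ S x u \<Longrightarrow> \<not> right_germ (- S) x u"
  using right_germ_Int[of S "- S" x u] not_right_germ_empty[of u x] by auto

lemma counterclockwise_edge_right_germ:
  assumes P: "polygon_with_vertices vs P" and ccw: "counterclockwise vs" and i: "i < length vs"
    and x: "x \<in> open_segment (vs ! i) (edge_end vs i)"
  defines "u \<equiv> edge_end vs i - vs ! i"
  shows "right_germ (- P) x u" "right_germ P x (- u)"
proof -
  note J = polygon_Jordan(6,7)[OF P]
  obtain e where e: "e > 0"
    "\<And>z. dist z x < e \<Longrightarrow> cross u (z - x) > 0 \<Longrightarrow> z \<in> inside (path_image (closed_polygonal_path vs))"
    "\<And>z. dist z x < e \<Longrightarrow> cross u (z - x) < 0 \<Longrightarrow> z \<in> outside (path_image (closed_polygonal_path vs))"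
    using counterclockwise_edge_sides[OF P ccw i x] unfolding u_def by metis
  have ev: "\<forall>\<^sub>F t in at_right (0::real). t > 0 \<and> dist (x + t *\<^sub>R w) x < e" for w
  proof (intro eventually_conj)
    show "\<forall>\<^sub>F t in at_right (0::real). t > 0" by (simp add: eventually_at_right_less)
    show "\<forall>\<^sub>F t in at_right (0::real). dist (x + t *\<^sub>R w) x < e"
      using eventually_at_right_scaleR[of "ball x e" x w] e(1) by (simp add: dist_commute)
  qed
  show "right_germ (- P) x u"
    unfolding right_germ_def
  proof (intro allI impI)
    fix w assume w: "cross u w < 0"
    show "\<forall>\<^sub>F t in at_right (0::real). x + t *\<^sub>R w \<in> - P"
    proof (rule eventually_mono[OF ev[of w]])
      fix t :: real assume t: "t > 0 \<and> dist (x + t *\<^sub>R w) x < e"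
      then have "cross u (x + t *\<^sub>R w - x) < 0" using w by (simp add: mult_pos_neg)
      then have "x + t *\<^sub>R w \<in> outside (path_image (closed_polygonal_path vs))" using t e(3) by blast
      then show "x + t *\<^sub>R w \<in> - P" using J(2) by blast
    qed
  qed
  show "right_germ P x (- u)"
    unfolding right_germ_def
  proof (intro allI impI)
    fix w assume w: "cross (- u) w < 0"
    show "\<forall>\<^sub>F t in at_right (0::real). x + t *\<^sub>R w \<in> P"
    proof (rule eventually_mono[OF ev[of w]])
      fix t :: real assume t: "t > 0 \<and> dist (x + t *\<^sub>R w) x < e"
      then have "cross u (x + t *\<^sub>R w - x) > 0" using w by simp
      then have "x + t *\<^sub>R w \<in> inside (path_image (closed_polygonal_path vs))" using t e(2) by blast
      then show "x + t *\<^sub>R w \<in> P" using J(1) by blast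
    qed
  qed
qed

text \<open>The ends of a segment are extreme points of it, so they are not interior to a
  subsegment.\<close>

lemma open_segment_subset_open_segment:
  assumes "closed_segment p q \<subseteq> closed_segment a b" "x \<in> open_segment p q"
  shows "x \<in> open_segment (a::complex) b"
proof -
  have "p \<in> closed_segment a b" "q \<in> closed_segment a b" "x \<in> closed_segment a b"
    using assms open_closed_segment by auto
  moreover have "x \<noteq> a" "x \<noteq> b"
    using extreme_point_of_segment[of a a b] extreme_point_of_segment[of b a b] calculation assms(2)
    unfolding extreme_point_of_def by blast+
  ultimately show ?thesis by (simp add: open_segment_def)
qed

text \<open>These consequences speak of \<open>P\<close> alone. They refute membership in
  \<open>boundary_segments\<close> for all vertex lists at once.\<close>

lemma boundary_segments_right_germ:
  assumes "(p, q) \<in> boundary_segments d P" "x \<in> open_segment p q"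
  shows "right_germ (- P) x (q - p)" "x \<in> frontier P"
proof -
  obtain vs i c where P: "polygon_with_vertices vs P" and ccw: "counterclockwise vs"
    and i: "i < length vs" and sub: "closed_segment p q \<subseteq> closed_segment (vs ! i) (edge_end vs i)"
    and c: "c > 0" "q - p = c *\<^sub>R (edge_end vs i - vs ! i)"
    using assms(1) unfolding boundary_segments_def by blast
  have x: "x \<in> open_segment (vs ! i) (edge_end vs i)"
    using open_segment_subset_open_segment[OF sub assms(2)] .
  show "right_germ (- P) x (q - p)"
    using counterclockwise_edge_right_germ(1)[OF P ccw i x] c by (simp add: right_germ_scaleR)
  show "x \<in> frontier P"
    unfolding frontier_polygon[OF P] path_image_closed_polygonal_path[OF polygon_Jordan(1)[OF P]]
    using x i by (auto simp: open_segment_def)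
qed

text \<open>In the coordinate with \<open>p\<close> at 0 and \<open>q\<close> at 1, the sample is at
  \<open>\<theta>\<close>, with \<open>a\<close> not after it and \<open>b\<close> not before it.
  Neither lattice point can lie strictly between 0 and 1, so \<open>a\<close> is at most 0 and
  \<open>b\<close> at least 1.\<close>

lemma minimal_segment_subset:
  assumes min: "minimal_segment d p q" and ab: "a \<in> lattice d" "b \<in> lattice d"
    and k: "b - a = k *\<^sub>R (q - p)" "k > 0" and \<theta>: "0 < \<theta>" "\<theta> < 1"
    and x: "sample \<theta> p q \<in> closed_segment a b"
  shows "closed_segment p q \<subseteq> closed_segment a b"
proof -
  obtain s where s: "0 \<le> s" "s \<le> 1" "sample \<theta> p q = (1 - s) *\<^sub>R a + s *\<^sub>R b"
    using x by (auto simp: in_segment)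
  then have "p + \<theta> *\<^sub>R (q - p) = a + s *\<^sub>R (b - a)" by (simp add: sample_def algebra_simps)
  then have "a = p + \<theta> *\<^sub>R (q - p) - (s * k) *\<^sub>R (q - p)" unfolding k(1) by simp
  then have a: "a = p + (\<theta> - s * k) *\<^sub>R (q - p)" by (simp add: scaleR_diff_left)
  have "b = a + k *\<^sub>R (q - p)" using k(1) by (simp add: algebra_simps)
  then have b: "b = p + (\<theta> + (1 - s) * k) *\<^sub>R (q - p)" unfolding a by (simp add: algebra_simps)
  have sk: "s * k \<ge> 0" "(1 - s) * k \<ge> 0" using s k by auto
  have A: "\<theta> - s * k \<le> 0"
    using minimal_segment_lattice_param[OF min ab(1)[unfolded a]] sk \<theta> by linarith
  have B: "\<theta> + (1 - s) * k \<ge> 1"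
    using minimal_segment_lattice_param[OF min ab(2)[unfolded b]] sk \<theta> by linarith
  have mem: "p + t *\<^sub>R (q - p) \<in> closed_segment a b" if t: "0 \<le> t" "t \<le> 1" for t
  proof -
    \<comment> \<open>The parameter, on the segment from \<open>a\<close> to \<open>b\<close>, of
      the point with coordinate \<open>t\<close>.\<close>
    define r where "r = (t - (\<theta> - s * k)) / k"
    have "a + r *\<^sub>R (b - a) = a + (r * k) *\<^sub>R (q - p)" unfolding k(1) by simp
    also have "r * k = t - (\<theta> - s * k)" using k(2) by (simp add: r_def)
    also have "a + (t - (\<theta> - s * k)) *\<^sub>R (q - p) = p + t *\<^sub>R (q - p)"
      by (subst a) (simp add: scaleR_diff_left)
    finally have "p + t *\<^sub>R (q - p) = a + r *\<^sub>R (b - a)" ..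
    then have "p + t *\<^sub>R (q - p) = (1 - r) *\<^sub>R a + r *\<^sub>R b" by (simp add: algebra_simps)
    moreover have "0 \<le> r" using A t k by (simp add: r_def)
    moreover have "r \<le> 1" using B t k by (simp add: r_def field_simps)
    ultimately show ?thesis unfolding in_segment by blast
  qed
  have "p \<in> closed_segment a b" "q \<in> closed_segment a b" using mem[of 0] mem[of 1] by auto
  then show ?thesis using closed_segment_subset convex_closed_segment by blast
qed

text \<open>Off the curve both terms of the jump agree. On it the irrational sample is interior to
  an edge parallel to the segment and belongs to \<open>P\<close>; its right side is outside
  \<open>P\<close> if the two directions agree, and inside if they are opposite.\<close>

lemma jump_polygon:
  assumes d: "d > 0" and vs: "polygon_with_vertices vs P" "set vs \<subseteq> lattice d"
    and min: "minimal_segment d p q" and \<theta>: "\<theta> \<notin> \<rat>" "0 < \<theta>" "\<theta> < 1"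
  shows "jump \<theta> P (p, q) = of_bool ((p, q) \<in> boundary_segments d P)"
proof -
  obtain us where us: "polygon_with_vertices us P" "counterclockwise us" "set us = set vs"
    using counterclockwise_vertices[OF vs(1)] .
  note J = polygon_Jordan[OF us(1)]
  define C where "C = path_image (closed_polygonal_path us)"
  define x where "x = sample \<theta> p q"
  have pq: "p \<noteq> q" "p \<in> rational_points" "q \<in> rational_points"
    using minimal_segment_lattice[OF min] lattice_rational[OF d] by auto
  have x: "x \<in> open_segment p q" using sample_in_open_segment \<theta> pq by (simp add: x_def)
  show ?thesis
  proof (cases "x \<in> C")
    case False
    then have "x \<in> inside C \<or> x \<in> outside C" using inside_Un_outside[of C] by blast
    then have "x \<in> interior P \<or> x \<notin> closure P"
    proof
      assume "x \<in> inside C"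
      then show ?thesis using J(2,6) interior_maximal[of "inside C" P] by (auto simp: C_def)
    next
      assume "x \<in> outside C"
      moreover have "closed P" using J(3,7) by (metis closed_Compl)
      ultimately show ?thesis using J(7) by (auto simp: C_def)
    qed
    then have "jump \<theta> P (p, q) = 0" using jump_eq_0 pq unfolding x_def by blast
    moreover have "(p, q) \<notin> boundary_segments d P"
      using boundary_segments_right_germ(2)[OF _ x] frontier_polygon[OF us(1)] False by (auto simp: C_def)
    ultimately show ?thesis by simp
  next
    case True
    then obtain i where i: "i < length us" and xi: "x \<in> closed_segment (us ! i) (edge_end us i)"
      unfolding C_def path_image_closed_polygonal_path[OF J(1)] by blast
    define a where "a = us ! i"
    define b where "b = edge_end us i"
    have "(i + 1) mod length us < length us" using J(1) by simp
    then have ab: "a \<in> lattice d" "b \<in> lattice d"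
      using i us(3) vs(2) by (auto simp: a_def b_def simp del: One_nat_def)
    then have abr: "a \<in> rational_points" "b \<in> rational_points" using lattice_rational[OF d] by auto
    then have "x \<noteq> a" "x \<noteq> b"
      using decided_singleton(2)[OF _ pq(2,3,1) \<theta>(1)] by (auto simp: x_def)
    then have xo: "x \<in> open_segment (us ! i) (edge_end us i)"
      using xi by (simp add: open_segment_def a_def b_def)
    then have "a \<noteq> b" by (auto simp: a_def b_def)
    obtain k where k: "k \<noteq> 0" "b - a = k *\<^sub>R (q - p)"
      using sample_on_rational_line[OF abr \<open>a \<noteq> b\<close> pq(2,3,1) \<theta>(1)] xi
      unfolding x_def a_def b_def by blast
    note rg = counterclockwise_edge_right_germ[OF us(1,2) i xo, folded a_def b_def]
    have "x \<in> P" using J(6) True by (simp add: C_def)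
    show ?thesis
    proof (cases "k > 0")
      case True
      then have R: "right_germ (- P) x (q - p)" using rg(1) k(2) by (simp add: right_germ_scaleR)
      then have "\<not> right_germ P x (q - p)" using not_right_germ_both pq(1) by auto
      moreover have "(p, q) \<in> boundary_segments d P"
      proof -
        have "closed_segment p q \<subseteq> closed_segment (us ! i) (edge_end us i)"
          using minimal_segment_subset[OF min ab k(2) True \<theta>(2,3)] xi
          by (simp add: x_def a_def b_def)
        moreover have "q - p = (1 / k) *\<^sub>R (edge_end us i - us ! i)"
          using k by (simp add: a_def b_def)
        moreover have "1 / k > 0" using True by simp
        ultimately show ?thesis
          unfolding boundary_segments_def using min us(1,2) i by blast
      qed
      ultimately show ?thesis using \<open>x \<in> P\<close> by (simp add: jump_def x_def)
    next
      case False
      then have "- k > 0" using k by simp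
      have "- (b - a) = (- k) *\<^sub>R (q - p)" using k(2) by simp
      then have R: "right_germ P x (q - p)"
        using rg(2) right_germ_scaleR[OF \<open>- k > 0\<close>] by metis
      then have "\<not> right_germ (- P) x (q - p)" using not_right_germ_both[of "q - p" P x] pq(1) by auto
      then have "(p, q) \<notin> boundary_segments d P" using boundary_segments_right_germ(1)[OF _ x] by blast
      then show ?thesis using R \<open>x \<in> P\<close> by (simp add: jump_def x_def)
    qed
  qed
qed

section \<open>Denominators\<close>

lemma lattice_mult: "z \<in> lattice n \<Longrightarrow> z \<in> lattice (m * n)"
  by (auto simp: lattice_def mult.assoc)

lemma rational_lattice:
  assumes "z \<in> rational_points"
  obtains n where "n > 0" "z \<in> lattice n"
proof -
  have *: "\<exists>n>0. real n * x \<in> \<int>" if x: "x \<in> \<rat>" for x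
  proof -
    obtain a b where b: "b > 0" and "x = of_int a / of_int b"
      using x by (rule Rats_cases')
    then have "real (nat b) * x = of_int a" using b by simp
    then have "real (nat b) * x \<in> \<int>" by simp
    moreover have "nat b > 0" using b by simp
    ultimately show ?thesis by blast
  qed
  obtain m n where mn: "m > 0" "real m * Re z \<in> \<int>" "n > 0" "real n * Im z \<in> \<int>"
    using assms *[of "Re z"] *[of "Im z"] by (auto simp: rational_points_def)
  have "real (m * n) * Re z = real n * (real m * Re z)" "real (m * n) * Im z = real m * (real n * Im z)"
    by simp_all
  then have "z \<in> lattice (m * n)"
    unfolding lattice_def mem_Collect_eq using mn by (metis Ints_mult Ints_of_nat)
  then show thesis using mn that[of "m * n"] by simp
qed

lemma common_lattice:
  assumes "finite V" "V \<subseteq> rational_points"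
  shows "\<exists>n>0. V \<subseteq> lattice n"
  using assms
proof (induction V)
  case empty
  then show ?case by auto
next
  case (insert z V)
  then obtain n where n: "n > 0" "V \<subseteq> lattice n" by auto
  obtain m where m: "m > 0" "z \<in> lattice m" using insert.prems rational_lattice by blast
  have "insert z V \<subseteq> lattice (m * n)"
    using lattice_mult[of _ n m] lattice_mult[of z m n] n m by (auto simp: mult.commute)
  then show ?case using n m by (intro exI[of _ "m * n"]) simp
qed

lemma linear_bij_times:
  assumes "c \<noteq> 0"
  shows "linear (\<lambda>z. c * z :: complex)" "bij (\<lambda>z. c * z :: complex)"
proof -
  show "linear (\<lambda>z. c * z :: complex)" by (rule linearI) (simp_all add: algebra_simps)
  show "bij (\<lambda>z. c * z :: complex)"
    by (rule bij_betw_byWitness[where f' = "\<lambda>z. z / c"]) (use assms in auto)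
qed

text \<open>\<open>LEAST\<close> says something only once some integral dilation is known; a common
  denominator of the rational vertices gives one. The integral vertices of the least dilation are
  then scaled back.\<close>

lemma denominator_vertices:
  assumes "rational_polygon P"
  obtains vs where "polygon_with_vertices vs P" "set vs \<subseteq> lattice (denominator P)" "denominator P > 0"
proof -
  let ?Q = "\<lambda>d. d > 0 \<and> integral_polygon ((\<lambda>z. of_nat d * z) ` P)"
  obtain us where us: "polygon_with_vertices us P" "set us \<subseteq> rational_points"
    using assms by (auto simp: rational_polygon_def)
  obtain n where n: "n > 0" "set us \<subseteq> lattice n" using common_lattice[OF _ us(2)] by auto
  have "polygon_with_vertices (map (\<lambda>z. of_nat n * z) us) ((\<lambda>z. of_nat n * z) ` P)"
    by (rule polygon_with_vertices_linear_image[OF linear_bij_times us(1)]) (use n in simp_all)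
  moreover have "set (map (\<lambda>z. of_nat n * z) us) \<subseteq> lattice 1"
    using n(2) by (auto simp: lattice_def)
  ultimately have "?Q n" using n(1) unfolding integral_polygon_def by blast
  then have D: "?Q (denominator P)" unfolding denominator_def by (rule LeastI)
  then obtain ws where ws: "polygon_with_vertices ws ((\<lambda>z. of_nat (denominator P) * z) ` P)" "set ws \<subseteq> lattice 1"
    unfolding integral_polygon_def by blast
  define c where "c = inverse (of_nat (denominator P) :: complex)"
  have c: "c \<noteq> 0" "c * of_nat (denominator P) = 1" using D by (auto simp: c_def)
  have "polygon_with_vertices (map (\<lambda>z. c * z) ws) ((\<lambda>z. c * z) ` (\<lambda>z. of_nat (denominator P) * z) ` P)"
    by (rule polygon_with_vertices_linear_image[OF linear_bij_times(1)[OF c(1)] linear_bij_times(2)[OF c(1)] ws(1)])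
  moreover have "(\<lambda>z. c * z) ` (\<lambda>z. of_nat (denominator P) * z) ` P = P"
    using c(2) by (simp add: image_image flip: mult.assoc)
  moreover have "set (map (\<lambda>z. c * z) ws) \<subseteq> lattice (denominator P)"
  proof -
    have "c * z \<in> lattice (denominator P)" if "z \<in> lattice 1" for z
    proof -
      have "of_nat (denominator P) * (c * z) = z" using c(2) by (simp flip: mult.assoc add: mult.commute)
      then have "real (denominator P) * Re (c * z) = Re z" "real (denominator P) * Im (c * z) = Im z"
        by (simp_all add: complex_eq_iff)
      then show ?thesis using that by (simp only: lattice_def mem_Collect_eq) simp
    qed
    then show ?thesis using ws(2) by auto
  qed
  ultimately show thesis using that D by metis
qed

section \<open>The invariant\<close>

definition jump_support :: "nat \<Rightarrow> int \<Rightarrow> real \<Rightarrow> complex set \<Rightarrow> (complex \<times> complex) set"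
  where "jump_support d k \<theta> S = {s \<in> weight_segments d k. total_jump \<theta> S s \<noteq> 0}"

text \<open>There are in general infinitely many segments of a given weight, and \<open>sum\<close>
  over an infinite set is 0 by default; hence the restriction to the support.\<close>

definition jump_sum :: "nat \<Rightarrow> int \<Rightarrow> real \<Rightarrow> complex set \<Rightarrow> int"
  where "jump_sum d k \<theta> S = (\<Sum>s\<in>jump_support d k \<theta> S. total_jump \<theta> S s)"

lemma jump_sum_superset:
  assumes "finite F" "jump_support d k \<theta> S \<subseteq> F" "F \<subseteq> weight_segments d k"
  shows "jump_sum d k \<theta> S = (\<Sum>s\<in>F. total_jump \<theta> S s)"
  unfolding jump_sum_def
  by (rule sum.mono_neutral_left) (use assms in \<open>auto simp: jump_support_def\<close>)

lemma G_maps_jump_sum: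
  assumes "g \<in> G_maps"
  shows "jump_sum d k \<theta> (g ` S) = jump_sum d k \<theta> S"
proof -
  obtain \<tau> where \<tau>: "bij_betw \<tau> (weight_segments d k) (weight_segments d k)"
    "\<And>\<theta> S s. total_jump \<theta> (g ` S) (\<tau> s) = total_jump \<theta> S s"
    by (rule G_maps_segment_bijection[OF assms, of d k]) blast
  have im: "\<tau> ` weight_segments d k = weight_segments d k" using \<tau>(1) by (simp add: bij_betw_def)
  have "\<tau> ` jump_support d k \<theta> S = jump_support d k \<theta> (g ` S)"
  proof
    show "\<tau> ` jump_support d k \<theta> S \<subseteq> jump_support d k \<theta> (g ` S)"
      using im \<tau>(2) by (auto simp: jump_support_def)
    show "jump_support d k \<theta> (g ` S) \<subseteq> \<tau> ` jump_support d k \<theta> S"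
    proof
      fix s assume s: "s \<in> jump_support d k \<theta> (g ` S)"
      then have "s \<in> \<tau> ` weight_segments d k" using im by (simp add: jump_support_def)
      then obtain t where "t \<in> weight_segments d k" "s = \<tau> t" by (rule imageE)
      then show "s \<in> \<tau> ` jump_support d k \<theta> S" using s \<tau>(2) by (auto simp: jump_support_def)
    qed
  qed
  moreover have "inj_on \<tau> (jump_support d k \<theta> S)"
    using \<tau>(1) by (auto simp: bij_betw_def jump_support_def intro: inj_on_subset)
  ultimately have bij: "bij_betw \<tau> (jump_support d k \<theta> S) (jump_support d k \<theta> (g ` S))"
    by (simp add: bij_betw_def)
  show "jump_sum d k \<theta> (g ` S) = jump_sum d k \<theta> S"
    unfolding jump_sum_def sum.reindex_bij_betw[OF bij, symmetric] \<tau>(2) ..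
qed

text \<open>Additivity is also applied to \<open>Q\<close>, whose pieces are the images.\<close>

lemma G_maps_rational_open_simplex:
  assumes "g \<in> G_maps" "rational_open_simplex T"
  shows "rational_open_simplex (g ` T)"
proof -
  obtain V where V: "V \<noteq> {}" "V \<subseteq> rational_points" "\<not> affine_dependent V" "T = rel_interior (convex hull V)"
    using assms(2) by (auto simp: rational_open_simplex_def)
  obtain L :: "complex \<Rightarrow> complex" where L: "linear L" and gL: "\<And>z w. g (z + w) = g z + L w" and "bij g"
    by (rule G_maps_properties[OF assms(1)]) blast
  have g: "g z = g 0 + L z" for z using gL[of 0 z] by simp
  have bL: "bounded_linear L" using L by (simp add: linear_conv_bounded_linear)
  have "inj L"
  proof (rule injI)
    fix x y assume "L x = L y"
    then have "g x = g y" unfolding g[of x] g[of y] by (rule arg_cong)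
    then show "x = y" using \<open>bij g\<close> by (auto simp: bij_def inj_def)
  qed
  have im: "g ` S = (+) (g 0) ` L ` S" for S
    unfolding image_image by (rule image_cong[OF refl g])
  have "g ` V \<subseteq> rational_points"
  proof (rule image_subsetI)
    fix z assume "z \<in> V"
    then have z: "Re z \<in> \<rat>" "Im z \<in> \<rat>" using V(2) by (auto simp: rational_points_def)
    obtain a b c e m n :: int where "\<And>z. g z = Complex (of_int a * Re z + of_int b * Im z + of_int m)
      (of_int c * Re z + of_int e * Im z + of_int n)"
      by (rule G_mapsE[OF assms(1)]) blast
    then show "g z \<in> rational_points" using z by (simp add: rational_points_def)
  qed
  moreover have "\<not> affine_dependent (g ` V)"
  proof -
    have "\<not> affine_dependent (L ` V)"
    proof
      assume "affine_dependent (L ` V)"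
      then obtain x where x: "x \<in> V" "L x \<in> affine hull (L ` V - {L x})"
        unfolding affine_dependent_def by blast
      have "L ` V - {L x} = L ` (V - {x})" using \<open>inj L\<close> by (auto simp: inj_def)
      then have "L x \<in> L ` (affine hull (V - {x}))"
        using x(2) bL by (simp only: affine_hull_linear_image)
      then have "x \<in> affine hull (V - {x})" using \<open>inj L\<close> by (simp only: inj_image_mem_iff)
      then show False using V(3) x(1) unfolding affine_dependent_def by blast
    qed
    then show ?thesis
      using affine_dependent_translation_eq[of "L ` V" "g 0"] by (simp only: im not_False_eq_True)
  qed
  moreover have "g ` T = rel_interior (convex hull (g ` V))"
    unfolding im V(4) convex_hull_translation convex_hull_linear_image[OF L, symmetric]
      rel_interior_translation rel_interior_injective_linear_image[OF bL \<open>inj L\<close>] ..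
  ultimately show ?thesis
    unfolding rational_open_simplex_def using V(1) by (intro exI[of _ "g ` V"]) simp
qed

lemma one_minus_not_Rats: "\<theta> \<notin> \<rat> \<Longrightarrow> 1 - \<theta> \<notin> \<rat>" for \<theta> :: real
  using Rats_diff[OF Rats_1, of "1 - \<theta>"] by (simp only: diff_diff_eq2 add_diff_cancel_left') blast

lemma finite_jump_support:
  assumes "d > 0" "rational_open_simplex T" "\<theta> \<notin> \<rat>"
  shows "finite (jump_support d k \<theta> T)"
proof -
  have "finite ({(p, q). minimal_segment d p q \<and> jump \<theta> T (p, q) \<noteq> 0} \<union>
      {(p, q). minimal_segment d p q \<and> jump (1 - \<theta>) T (p, q) \<noteq> 0})"
    using finite_jump_rational_simplex[OF assms(1,2)] assms(3) one_minus_not_Rats by simp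
  then show ?thesis
    by (rule rev_finite_subset) (auto simp: jump_support_def weight_segments_def total_jump_def)
qed

lemma total_jump_Union:
  assumes d: "d > 0" and \<theta>: "\<theta> \<notin> \<rat>" and I: "finite I" "disjoint_family_on T I"
    and T: "\<And>i. i \<in> I \<Longrightarrow> rational_open_simplex (T i)" and s: "s \<in> weight_segments d k"
  shows "total_jump \<theta> (\<Union>i\<in>I. T i) s = (\<Sum>i\<in>I. total_jump \<theta> (T i) s)"
proof -
  obtain p q where pq: "s = (p, q)" and "minimal_segment d p q"
    using s by (auto simp: weight_segments_def)
  then have r: "p \<in> rational_points" "q \<in> rational_points" "p \<noteq> q"
    using minimal_segment_lattice lattice_rational[OF d] by blast+
  have dec: "decided (T i) (sample t p q) (q - p)" if i: "i \<in> I" and t: "t \<notin> \<rat>" for i t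
  proof -
    obtain V where "V \<noteq> {}" "V \<subseteq> rational_points" "\<not> affine_dependent V" "T i = rel_interior (convex hull V)"
      using T[OF i] by (auto simp: rational_open_simplex_def)
    then show ?thesis using rational_simplex_jump(1)[OF _ _ _ r t] by simp
  qed
  show ?thesis
    unfolding total_jump_def pq sum.distrib
    using jump_Union[OF r(3) I dec] \<theta> one_minus_not_Rats[OF \<theta>] by simp
qed

text \<open>Summing every piece over the one finite set \<open>F\<close>, the union of their
  supports, allows the two sums to be exchanged. The second claim later yields that \<open>P\<close>
  and \<open>Q\<close> have finitely many boundary segments of each weight.\<close>

lemma jump_sum_Union:
  assumes d: "d > 0" and \<theta>: "\<theta> \<notin> \<rat>" and I: "finite I" "disjoint_family_on T I"
    and T: "\<And>i. i \<in> I \<Longrightarrow> rational_open_simplex (T i)"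
  shows "jump_sum d k \<theta> (\<Union>i\<in>I. T i) = (\<Sum>i\<in>I. jump_sum d k \<theta> (T i))"
    and "finite (jump_support d k \<theta> (\<Union>i\<in>I. T i))"
proof -
  define F where "F = (\<Union>i\<in>I. jump_support d k \<theta> (T i))"
  have F: "finite F" "F \<subseteq> weight_segments d k"
    using I(1) finite_jump_support[OF d T \<theta>] by (auto simp: F_def jump_support_def)
  have U: "total_jump \<theta> (\<Union>i\<in>I. T i) s = (\<Sum>i\<in>I. total_jump \<theta> (T i) s)"
    if "s \<in> weight_segments d k" for s
    using total_jump_Union[OF d \<theta> I T that] by blast
  have sub: "jump_support d k \<theta> (\<Union>i\<in>I. T i) \<subseteq> F"
  proof
    fix s assume s: "s \<in> jump_support d k \<theta> (\<Union>i\<in>I. T i)"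
    then have "s \<in> weight_segments d k" by (simp add: jump_support_def)
    moreover have "(\<Sum>i\<in>I. total_jump \<theta> (T i) s) \<noteq> 0"
      using s U[OF \<open>s \<in> weight_segments d k\<close>] by (simp add: jump_support_def)
    then obtain i where "i \<in> I" "total_jump \<theta> (T i) s \<noteq> 0" by (meson sum.not_neutral_contains_not_neutral)
    then show "s \<in> F" using \<open>s \<in> weight_segments d k\<close> by (auto simp: F_def jump_support_def)
  qed
  then show "finite (jump_support d k \<theta> (\<Union>i\<in>I. T i))" using F(1) by (rule finite_subset)
  have "jump_sum d k \<theta> (\<Union>i\<in>I. T i) = (\<Sum>s\<in>F. \<Sum>i\<in>I. total_jump \<theta> (T i) s)"
    unfolding jump_sum_superset[OF F(1) sub F(2)] using F(2) by (intro sum.cong U) auto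
  also have "\<dots> = (\<Sum>i\<in>I. \<Sum>s\<in>F. total_jump \<theta> (T i) s)" by (rule sum.swap)
  also have "\<dots> = (\<Sum>i\<in>I. jump_sum d k \<theta> (T i))"
    using F by (intro sum.cong refl jump_sum_superset[symmetric]) (auto simp: F_def)
  finally show "jump_sum d k \<theta> (\<Union>i\<in>I. T i) = (\<Sum>i\<in>I. jump_sum d k \<theta> (T i))" .
qed

text \<open>The factor 2 comes from the two parameters \<open>\<theta>\<close> and
  \<open>1 - \<theta>\<close>, each of which detects every boundary segment once.\<close>

lemma jump_sum_polygon:
  assumes d: "d > 0" and vs: "polygon_with_vertices vs P" "set vs \<subseteq> lattice d"
    and \<theta>: "\<theta> \<notin> \<rat>" "0 < \<theta>" "\<theta> < 1"
  shows "jump_support d k \<theta> P = {(p, q) \<in> boundary_segments d P. weight d p q = k}"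
    "jump_sum d k \<theta> P = 2 * int (card {(p, q) \<in> boundary_segments d P. weight d p q = k})"
proof -
  have tj: "total_jump \<theta> P s = 2 * of_bool (s \<in> boundary_segments d P)" if sw: "s \<in> weight_segments d k" for s
  proof -
    obtain p q where s: "s = (p, q)" and "minimal_segment d p q"
      using sw by (auto simp: weight_segments_def)
    then show ?thesis
      using jump_polygon[OF d vs _ \<theta>] jump_polygon[OF d vs _ one_minus_not_Rats[OF \<theta>(1)]] \<theta>
      by (simp add: total_jump_def)
  qed
  have "\<And>p q. (p, q) \<in> boundary_segments d P \<Longrightarrow> minimal_segment d p q"
    unfolding boundary_segments_def by blast
  then show *: "jump_support d k \<theta> P = {(p, q) \<in> boundary_segments d P. weight d p q = k}"
    using tj by (auto simp: jump_support_def weight_segments_def)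
  have "jump_sum d k \<theta> P = (\<Sum>s\<in>jump_support d k \<theta> P. 2)"
    unfolding jump_sum_def
  proof (rule sum.cong)
    fix s assume "s \<in> jump_support d k \<theta> P"
    moreover have "s \<in> boundary_segments d P" using calculation unfolding * by auto
    ultimately have "s \<in> weight_segments d k" "s \<in> boundary_segments d P"
      by (simp_all add: jump_support_def)
    then show "total_jump \<theta> P s = 2" using tj by simp
  qed simp
  then show "jump_sum d k \<theta> P = 2 * int (card {(p, q) \<in> boundary_segments d P. weight d p q = k})"
    unfolding * by simp
qed

text \<open>Weights take only \<open>d\<close> values, so finiteness for each value gives finiteness
  of \<open>boundary_segments d P\<close>; for an infinite set \<open>mset_set\<close> would be
  empty.\<close>

lemma count_weights:
  assumes d: "d > 0"
    and fin: "\<And>k. finite {(p, q) \<in> boundary_segments d P. weight d p q = k}"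
  shows "count (weights d P) k = card {(p, q) \<in> boundary_segments d P. weight d p q = k}"
proof -
  have "weight d p q \<in> {0..<int d}" for p q
    using d by (simp add: weight_def Let_def)
  then have "boundary_segments d P \<subseteq> (\<Union>k\<in>{0..<int d}. {(p, q) \<in> boundary_segments d P. weight d p q = k})"
    by auto
  then have "finite (boundary_segments d P)"
    using fin by (meson finite_UN_I finite_atLeastLessThan_int finite_subset)
  moreover have "(\<Sum>s\<in>{(p, q) \<in> boundary_segments d P. weight d p q = k}. count (mset_set (boundary_segments d P)) s) =
      (\<Sum>s\<in>{(p, q) \<in> boundary_segments d P. weight d p q = k}. 1)"
    using calculation by (intro sum.cong) auto
  moreover have "(\<lambda>(p, q). weight d p q) -` {k} \<inter> boundary_segments d P =
      {(p, q) \<in> boundary_segments d P. weight d p q = k}"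
    by auto
  ultimately show ?thesis
    unfolding weights_def count_image_mset by simp
qed

theorem mainTheorem13:
  fixes P Q :: "complex set" and d :: nat
  assumes "rational_polygon P" and "denominator P = d"
    and "rational_polygon Q" and "denominator Q = d"
    and "equidecomposable P Q"
  shows "weights d P = weights d Q"
proof -
  obtain vs where vs: "polygon_with_vertices vs P" "set vs \<subseteq> lattice d" and d: "d > 0"
    using denominator_vertices[OF assms(1)] assms(2) by metis
  obtain us where us: "polygon_with_vertices us Q" "set us \<subseteq> lattice d"
    using denominator_vertices[OF assms(3)] assms(4) by metis
  have "\<not> {0<..<1::real} \<subseteq> \<rat>"
    using countable_subset[OF _ countable_rat] uncountable_open_interval[of 0 "1::real"] by auto
  then obtain \<theta> :: real where \<theta>: "\<theta> \<notin> \<rat>" "0 < \<theta>" "\<theta> < 1"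
    unfolding subset_iff greaterThanLessThan_iff by blast
  obtain r :: nat and T g where T: "\<And>i. i < r \<Longrightarrow> rational_open_simplex (T i)"
    and g: "\<And>i. i < r \<Longrightarrow> g i \<in> G_maps"
    and P: "disjoint_family_on T {..<r}" "P = (\<Union>i<r. T i)"
    and Q: "disjoint_family_on (\<lambda>i. g i ` T i) {..<r}" "Q = (\<Union>i<r. g i ` T i)"
    using assms(5) unfolding equidecomposable_def by blast
  have sP: "jump_sum d k \<theta> P = (\<Sum>i<r. jump_sum d k \<theta> (T i))"
    and fP: "finite (jump_support d k \<theta> P)" for k
    unfolding P(2) using jump_sum_Union[OF d \<theta>(1) finite_lessThan P(1)] T by auto
  have sQ: "jump_sum d k \<theta> Q = (\<Sum>i<r. jump_sum d k \<theta> (g i ` T i))"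
    and fQ: "finite (jump_support d k \<theta> Q)" for k
    unfolding Q(2) using jump_sum_Union[OF d \<theta>(1) finite_lessThan Q(1)] T g G_maps_rational_open_simplex
    by auto
  have "count (weights d P) k = count (weights d Q) k" for k
  proof -
    have "jump_sum d k \<theta> P = jump_sum d k \<theta> Q"
      unfolding sP sQ using G_maps_jump_sum[OF g] by (intro sum.cong) auto
    then have "card {(p, q) \<in> boundary_segments d P. weight d p q = k} =
        card {(p, q) \<in> boundary_segments d Q. weight d p q = k}"
      unfolding jump_sum_polygon(2)[OF d vs \<theta>] jump_sum_polygon(2)[OF d us \<theta>] by simp
    then show ?thesis
      using count_weights[OF d fP[unfolded jump_sum_polygon(1)[OF d vs \<theta>]]]
        count_weights[OF d fQ[unfolded jump_sum_polygon(1)[OF d us \<theta>]]] by simp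
  qed
  then show ?thesis by (rule multiset_eqI)
qed

end
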